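(* Let $X$ be a (complex) Banach space. For $2\leq q<\infty$ and $C\geq 1$, the following statements are equivalent: (a) $X$ has Fourier cotype $q$ with constant $C$; (b) every Dirichlet series $D=\sum a_n n^{-s}\in\mathcal{H}_{q'}(X)$ satisfies \[ \Big(\sum_{n=1}^\infty \|a_n\|_X^{q}\Big)^{1/q}\leq C\,\|D\|_{\mathcal{H}_{q'}(X)}; \] (c) every $f\in H_{q'}(\mathbb{T}^\infty,X)$ satisfies \[ \Big(\sum_{\alpha\in\mathbb{N}_0^{(\mathbb{N})}}\|\hat f(\alpha)\|_X^{q}\Big)^{1/q}\leq C\,\|f\|_{H_{q'}(\mathbb{T}^\infty,X)}. \]
   Context: Here $q'$ is the conjugate exponent, $\frac1q+\frac1{q'}=1$. $X$ has Fourier cotype $q$ with constant $C$ if for each choice of finitely many vectors $x_1,\dots,x_N\in X$ \[ \Big(\sum_{k=1}^N\|x_k\|^q\Big)^{1/q}\leq C\Big(\int_{\mathbb{T}}\Big\|\sum_{k=1}^N x_kz^k\Big\|^{q'}dz\Big)^{1/q'}, \] where $\mathbb{T}$ is the unit circle in $\mathbb{C}$ and $dz$ the normalized Lebesgue measure. $\mathbb{T}^\infty=\prod_{k=1}^\infty\mathbb{T}$ carries the product of the normalized Lebesgue measures, also denoted $dz$. $\mathbb{Z}^{(\mathbb{N})}$ is the set of finitely supported sequences of integers, and $\mathbb{N}_0^{(\mathbb{N})}$ the subset of those with all entries $\geq0$. For $f\in L_1(\mathbb{T}^\infty,X)$ (Bochner) and $\alpha\in\mathbb{Z}^{(\mathbb{N})}$,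 $\hat f(\alpha)=\int_{\mathbb{T}^\infty}f(z)z^{-\alpha}dz$. For $1\le p<\infty$, \[ H_p(\mathbb{T}^\infty,X)=\{f\in L_p(\mathbb{T}^\infty,X):\hat f(\alpha)=0\ \ \forall \alpha\in\mathbb{Z}^{(\mathbb{N})}\setminus\mathbb{N}_0^{(\mathbb{N})}\} \] with the $L_p$ norm. The Bohr transform $\mathfrak{B}_X$ assigns to $f\in H_p(\mathbb{T}^\infty,X)$ the (formal) Dirichlet series $\sum a_nn^{-s}$ with $a_n=\hat f(\alpha)$ whenever $n=\mathfrak p_1^{\alpha_1}\cdots \mathfrak p_k^{\alpha_k}$ is the prime factorization of $n$ ($\mathfrak p_1<\mathfrak p_2<\dots$ the primes). $\mathcal{H}_p(X)$ is the image of $H_p(\mathbb{T}^\infty,X)$ under the (injective) map $\mathfrak{B}_X$, with norm $\|D\|_{\mathcal{H}_p(X)}=\|\mathfrak{B}_X^{-1}(D)\|_{H_p(\mathbb{T}^\infty,X)}$. *)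

theory Defs
  imports "HOL-Probability.Probability" "HOL-Computational_Algebra.Primes"
    "HOL-Library.Infinite_Set"
begin

section \<open>Complex Banach spaces\<close>

class scaleC =
  fixes scaleC :: "complex \<Rightarrow> 'a \<Rightarrow> 'a" (infixr \<open>*\<^sub>C\<close> 75)

class complex_vector = scaleC + real_vector +
  assumes scaleC_add_right: "a *\<^sub>C (x + y) = a *\<^sub>C x + a *\<^sub>C y"
    and scaleC_add_left: "(a + b) *\<^sub>C x = a *\<^sub>C x + b *\<^sub>C x"
    and scaleC_scaleC: "a *\<^sub>C b *\<^sub>C x = (a * b) *\<^sub>C x"
    and scaleC_one: "1 *\<^sub>C x = x"
    and scaleR_scaleC: "r *\<^sub>R x = complex_of_real r *\<^sub>C x"

class complex_normed_vector = complex_vector + real_normed_vector +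
  assumes norm_scaleC: "norm (a *\<^sub>C x) = cmod a * norm x"

class complex_banach = complex_normed_vector + complete_space

subclass (in complex_banach) banach ..

instantiation complex :: complex_banach
begin

definition scaleC_complex :: "complex \<Rightarrow> complex \<Rightarrow> complex" where
  "scaleC_complex a x = a * x"

instance
  by standard (simp_all add: scaleC_complex_def algebra_simps norm_mult scaleR_conv_of_real)

end


section \<open>Conjugate exponents\<close>

definition conj_exponent :: "real \<Rightarrow> real" where
  "conj_exponent q = q / (q - 1)"

lemma conj_exponent:
  assumes "q > 1"
  shows "1 / q + 1 / conj_exponent q = 1"
  using assms by (simp add: conj_exponent_def field_simps)


section \<open>The Bochner integral and the spaces \<open>L\<^sub>p\<close>\<close>

text \<open>
  The library's Bochner integral requires the target space to be second countable. The following
  version works in an arbitrary Banach space; measurability is strong measurability, i.e. being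
  an almost everywhere limit of simple functions.
\<close>

definition strongly_measurable :: "'s measure \<Rightarrow> ('s \<Rightarrow> 'a::real_normed_vector) \<Rightarrow> bool" where
  "strongly_measurable M f \<longleftrightarrow>
     (\<exists>s. (\<forall>i. simple_function M (s i)) \<and> (AE x in M. (\<lambda>i. s i x) \<longlonglongrightarrow> f x))"

definition has_bochner_int ::
  "'s measure \<Rightarrow> ('s \<Rightarrow> 'a::real_normed_vector) \<Rightarrow> 'a \<Rightarrow> bool" where
  "has_bochner_int M f x \<longleftrightarrow> strongly_measurable M f \<and>
     (\<exists>s. (\<forall>i. Bochner_Integration.simple_bochner_integrable M (s i)) \<and>
          (\<lambda>i. \<integral>\<^sup>+ y. ennreal (norm (f y - s i y)) \<partial>M) \<longlonglongrightarrow> 0 \<and>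
          (\<lambda>i. Bochner_Integration.simple_bochner_integral M (s i)) \<longlonglongrightarrow> x)"

definition bochner_int :: "'s measure \<Rightarrow> ('s \<Rightarrow> 'a::real_normed_vector) \<Rightarrow> 'a" where
  "bochner_int M f =
     (if \<exists>x. has_bochner_int M f x then THE x. has_bochner_int M f x else 0)"

text \<open>
  Elements of \<open>L\<^sub>p\<close> are represented by functions, without passing to the quotient modulo almost
  everywhere equality. The nonnegative integral does not change under modification of its integrand
  on a null set, even a nonmeasurable one, so all notions below respect this equality.
\<close>

definition Lp_space :: "real \<Rightarrow> 's measure \<Rightarrow> ('s \<Rightarrow> 'a::real_normed_vector) set" where
  "Lp_space p M =
     {f. strongly_measurable M f \<and> (\<integral>\<^sup>+ x. ennreal (norm (f x) powr p) \<partial>M) < \<infinity>}"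

definition Lp_norm :: "real \<Rightarrow> 's measure \<Rightarrow> ('s \<Rightarrow> 'a::real_normed_vector) \<Rightarrow> real" where
  "Lp_norm p M f = enn2real (\<integral>\<^sup>+ x. ennreal (norm (f x) powr p) \<partial>M) powr (1 / p)"


section \<open>The circle and the infinite torus\<close>

text \<open>The underlying set of this measure space is the unit circle, not the complex plane.\<close>

definition circle_measure :: "complex measure" where
  "circle_measure =
     distr (uniform_measure lborel {0..2 * pi}) (restrict_space borel (sphere 0 1)) cis"

text \<open>Coordinates are numbered from 0.\<close>

definition torus_measure :: "(nat \<Rightarrow> complex) measure" where
  "torus_measure = (\<Pi>\<^sub>M k\<in>UNIV. circle_measure)"

lemma space_circle_measure: "space circle_measure = sphere 0 1"
  by (simp add: circle_measure_def space_restrict_space)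

lemma prob_space_circle_measure: "prob_space circle_measure"
proof -
  have cis: "cis \<in> borel_measurable borel"
    by (intro borel_measurable_continuous_onI) (auto intro: continuous_intros)
  have "cis \<in> uniform_measure lborel {0..2 * pi} \<rightarrow>\<^sub>M restrict_space borel (sphere 0 1)"
    by (rule measurable_restrict_space2) (use cis in \<open>auto simp: measurable_def\<close>)
  moreover have "prob_space (uniform_measure lborel {0..2 * pi})"
    by (rule prob_space_uniform_measure) auto
  ultimately show ?thesis
    unfolding circle_measure_def by (intro prob_space.prob_space_distr)
qed

lemma prob_space_torus_measure: "prob_space torus_measure"
  unfolding torus_measure_def by (intro prob_space_PiM prob_space_circle_measure)


section \<open>Fourier cotype\<close>

definition fourier_cotype :: "'a::complex_banach itself \<Rightarrow> real \<Rightarrow> real \<Rightarrow> bool" where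
  "fourier_cotype X q C \<longleftrightarrow>
     (\<forall>(N::nat) (x :: nat \<Rightarrow> 'a).
        (\<Sum>k=1..N. norm (x k) powr q) powr (1 / q)
        \<le> C * (\<integral>z. norm (\<Sum>k=1..N. z ^ k *\<^sub>C x k) powr conj_exponent q \<partial>circle_measure)
              powr (1 / conj_exponent q))"


section \<open>Hardy spaces on the infinite torus\<close>

definition int_multi_indices :: "(nat \<Rightarrow> int) set" where
  "int_multi_indices = {\<alpha>. finite {k. \<alpha> k \<noteq> 0}}"

definition nonneg_multi_indices :: "(nat \<Rightarrow> int) set" where
  "nonneg_multi_indices = {\<alpha> \<in> int_multi_indices. \<forall>k. \<alpha> k \<ge> 0}"

definition monomial :: "(nat \<Rightarrow> complex) \<Rightarrow> (nat \<Rightarrow> int) \<Rightarrow> complex" where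
  "monomial z \<alpha> = (\<Prod>k | \<alpha> k \<noteq> 0. z k powi \<alpha> k)"

definition fourier_coeff ::
  "((nat \<Rightarrow> complex) \<Rightarrow> 'a::complex_banach) \<Rightarrow> (nat \<Rightarrow> int) \<Rightarrow> 'a" where
  "fourier_coeff f \<alpha> = bochner_int torus_measure (\<lambda>z. monomial z (\<lambda>k. - \<alpha> k) *\<^sub>C f z)"

definition hardy_space :: "real \<Rightarrow> ((nat \<Rightarrow> complex) \<Rightarrow> 'a::complex_banach) set" where
  "hardy_space p =
     {f \<in> Lp_space p torus_measure.
        \<forall>\<alpha> \<in> int_multi_indices - nonneg_multi_indices. fourier_coeff f \<alpha> = 0}"


section \<open>The Bohr transform and Hardy spaces of Dirichlet series\<close>

definition nth_prime :: "nat \<Rightarrow> nat" where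
  "nth_prime = enumerate {p. prime p}"

definition prime_exponents :: "nat \<Rightarrow> nat \<Rightarrow> int" where
  "prime_exponents n = (\<lambda>k. int (multiplicity (nth_prime k) n))"

text \<open>
  A formal Dirichlet series is represented by its sequence of coefficients \<open>a\<^sub>n\<close>, \<open>n \<ge> 1\<close>;
  the meaningless entry at index 0 is fixed to be 0.
\<close>

definition bohr_transform ::
  "((nat \<Rightarrow> complex) \<Rightarrow> 'a::complex_banach) \<Rightarrow> nat \<Rightarrow> 'a" where
  "bohr_transform f = (\<lambda>n. if n = 0 then 0 else fourier_coeff f (prime_exponents n))"

definition hardy_dirichlet :: "real \<Rightarrow> (nat \<Rightarrow> 'a::complex_banach) set" where
  "hardy_dirichlet p = bohr_transform ` hardy_space p"

text \<open>
  The Bohr transform is injective only up to almost everywhere equality, so \<^const>\<open>inv_into\<close>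
  selects a representative of the preimage; its norm does not depend on the selection.
\<close>

definition hardy_dirichlet_norm :: "real \<Rightarrow> (nat \<Rightarrow> 'a::complex_banach) \<Rightarrow> real" where
  "hardy_dirichlet_norm p D =
     Lp_norm p torus_measure (inv_into (hardy_space p) bohr_transform D)"

end

(*
  The heart of the matter is that Fourier cotype gives the Hausdorff--Young inequality for every
  trigonometric polynomial P on the torus: along the curve z |-> (z, z^m, z^(m^2), ...) distinct
  monomials of P become distinct powers of z once m avoids finitely many roots, and, by
  Stone--Weierstrass, the mean of |P|^q' along such curves tends to its mean over the torus.
  Multiplication by a power of z makes all exponents positive, so P need not be analytic; hence
  density of the trigonometric polynomials in L_q' is enough to reach all of L_q', and no analytic
  approximation of functions in H_q' is needed. Conversely, polynomials in one variable of the
  torus recover the cotype inequality. Statements (b) and (c) correspond under unique prime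
  factorisation; since the norm in (b) refers to a chosen preimage under the Bohr transform, this
  uses that an integrable function with vanishing Fourier coefficients vanishes almost everywhere.
*)
theory Submission
  imports Defs
begin

section \<open>Strong measurability and the Bochner integral\<close>

text \<open>Two constraints shape the proof. \<open>X\<close> need not be separable, and strong
  measurability holds only up to null sets: differences of Borel functions with values in
  \<open>X\<close> may fail to be Borel, and \<open>nn_integral\<close> need not be additive on the
  given functions. So functions are exchanged for a.e. equal everywhere limits of simple functions
  (\<open>simple_limit\<close>), a class closed under sums and scalar multiples, before their norms
  are integrated. Moreover, \<open>C\<close> must survive exactly. For q' < 2 the function |P|^q' is
  in general not a trigonometric polynomial, so no single curve need reproduce its mean; only a
  limit over curves does. This is harmless because the coefficients on the other side do not change
  with the curve. In the passage from polynomials to L_q' a triangle inequality with a factor 2^q'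
  would spoil the constant, so convexity with a weight tending to 0 takes its place.\<close>

definition simple_limit :: "'s measure \<Rightarrow> ('s \<Rightarrow> 'a::real_normed_vector) \<Rightarrow> bool" where
  "simple_limit M f \<longleftrightarrow>
     (\<exists>s. (\<forall>i. simple_function M (s i)) \<and> (\<forall>x\<in>space M. (\<lambda>i. s i x) \<longlonglongrightarrow> f x))"

lemma simple_limit_simple_function: "simple_function M f \<Longrightarrow> simple_limit M f"
  unfolding simple_limit_def by (rule exI[of _ "\<lambda>_. f"]) auto

lemma simple_limit_compose2:
  assumes "simple_limit M f" "simple_limit M g"
    and h: "\<And>s t a b. s \<longlonglongrightarrow> a \<Longrightarrow> t \<longlonglongrightarrow> b \<Longrightarrow> (\<lambda>n. h (s n) (t n)) \<longlonglongrightarrow> h a b"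
  shows "simple_limit M (\<lambda>x. h (f x) (g x))"
proof -
  obtain s t where "\<And>i. simple_function M (s i)" "\<And>x. x \<in> space M \<Longrightarrow> (\<lambda>i. s i x) \<longlonglongrightarrow> f x"
    "\<And>i. simple_function M (t i)" "\<And>x. x \<in> space M \<Longrightarrow> (\<lambda>i. t i x) \<longlonglongrightarrow> g x"
    using assms(1,2) unfolding simple_limit_def by metis
  then show ?thesis
    unfolding simple_limit_def
    by (intro exI[of _ "\<lambda>i x. h (s i x) (t i x)"]) (auto intro: h simple_function_compose2)
qed

lemma simple_limit_add: "simple_limit M f \<Longrightarrow> simple_limit M g \<Longrightarrow> simple_limit M (\<lambda>x. f x + g x)"
  by (rule simple_limit_compose2) (auto intro: tendsto_add)

lemma simple_limit_diff: "simple_limit M f \<Longrightarrow> simple_limit M g \<Longrightarrow> simple_limit M (\<lambda>x. f x - g x)"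
  by (rule simple_limit_compose2) (auto intro: tendsto_diff)

text \<open>The interpretation below turns this into the limit, continuity, sum and zero rules for
  \<open>scaleC\<close> that the rest of the proof cites.\<close>

lemma bounded_bilinear_scaleC:
  "bounded_bilinear (scaleC :: complex \<Rightarrow> 'a \<Rightarrow> 'a::complex_normed_vector)"
proof
  show "\<exists>K. \<forall>a b. norm (a *\<^sub>C b :: 'a) \<le> norm a * norm b * K"
    by (rule exI[of _ 1]) (simp add: norm_scaleC)
  fix r :: real and a :: complex and b :: 'a
  show "(r *\<^sub>R a) *\<^sub>C b = r *\<^sub>R a *\<^sub>C b"
    by (simp add: scaleR_scaleC scaleC_scaleC scaleC_complex_def)
  show "a *\<^sub>C r *\<^sub>R b = r *\<^sub>R a *\<^sub>C b"
    by (simp add: scaleR_scaleC scaleC_scaleC mult.commute)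
qed (auto simp: scaleC_add_left scaleC_add_right)

interpretation scaleC: bounded_bilinear "scaleC :: complex \<Rightarrow> 'a \<Rightarrow> 'a::complex_normed_vector"
  by (rule bounded_bilinear_scaleC)

lemma simple_limit_scaleC:
  fixes f :: "'s \<Rightarrow> 'a::complex_normed_vector"
  shows "simple_limit M c \<Longrightarrow> simple_limit M f \<Longrightarrow> simple_limit M (\<lambda>x. c x *\<^sub>C f x)"
  by (rule simple_limit_compose2[where h = scaleC]) (auto intro: scaleC.tendsto)

lemma simple_limit_const: "simple_limit M (\<lambda>x. c)"
  by (intro simple_limit_simple_function) simp

lemma simple_limit_sum:
  assumes "\<And>i. i \<in> I \<Longrightarrow> simple_limit M (f i)"
  shows "simple_limit M (\<lambda>x. \<Sum>i\<in>I. f i x)"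
  using assms
  by (induction I rule: infinite_finite_induct) (auto intro: simple_limit_const simple_limit_add)

lemma borel_measurable_simple_limit:
  assumes "simple_limit M f"
  shows "f \<in> borel_measurable M"
proof -
  obtain s where s: "\<And>i. simple_function M (s i)" "\<And>x. x \<in> space M \<Longrightarrow> (\<lambda>i. s i x) \<longlonglongrightarrow> f x"
    using assms unfolding simple_limit_def by metis
  show ?thesis
    by (rule borel_measurable_LIMSEQ_metric[of s])
       (auto intro: s borel_measurable_simple_function)
qed

text \<open>For vector-valued \<open>f\<close> and \<open>g\<close>, measurability of
  \<open>norm (f x - g x)\<close> is obtained by first forming the difference inside the class
  \<open>simple_limit\<close>; Borel measurability of \<open>f\<close> and \<open>g\<close>
  separately would not give it.\<close>

lemma borel_measurable_norm_simple_limit: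
  "simple_limit M f \<Longrightarrow> (\<lambda>x. norm (f x)) \<in> borel_measurable M"
  by (rule measurable_compose[OF borel_measurable_simple_limit borel_measurable_norm])

lemma simple_limit_borel_measurable:
  fixes f :: "'s \<Rightarrow> 'a::{real_normed_vector, second_countable_topology}"
  assumes "f \<in> borel_measurable M"
  shows "simple_limit M f"
  using borel_measurable_implies_sequence_metric[OF assms, of 0]
  unfolding simple_limit_def by metis

section \<open>Strong measurability modulo null sets\<close>

lemma strongly_measurable_simple_limit: "simple_limit M f \<Longrightarrow> strongly_measurable M f"
  unfolding simple_limit_def strongly_measurable_def by blast

lemma strongly_measurable_cong_AE:
  assumes "AE x in M. f x = g x"
  shows "strongly_measurable M f \<longleftrightarrow> strongly_measurable M g"
proof -
  have *: "strongly_measurable M g" if fg: "AE x in M. f x = g x" and f: "strongly_measurable M f"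
    for f g :: "_ \<Rightarrow> 'b"
  proof -
    obtain s where s: "\<And>i. simple_function M (s i)" "AE x in M. (\<lambda>i. s i x) \<longlonglongrightarrow> f x"
      using f unfolding strongly_measurable_def by blast
    have "AE x in M. (\<lambda>i. s i x) \<longlonglongrightarrow> g x"
      using s(2) fg by eventually_elim simp
    then show ?thesis
      using s(1) unfolding strongly_measurable_def by blast
  qed
  show ?thesis
    using *[of f g] *[of g f] assms by (auto simp: eq_commute)
qed

text \<open>A measurable null set covers the points of divergence; setting both \<open>f\<close> and
  the simple functions to 0 there makes the convergence hold everywhere.\<close>

lemma strongly_measurableE:
  assumes "strongly_measurable M f"
  obtains g where "simple_limit M g" "AE x in M. f x = g x"
proof -
  obtain s where s: "\<And>i. simple_function M (s i)" "AE x in M. (\<lambda>i. s i x) \<longlonglongrightarrow> f x"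
    using assms unfolding strongly_measurable_def by blast
  obtain N where N: "N \<in> null_sets M" "{x\<in>space M. \<not> (\<lambda>i. s i x) \<longlonglongrightarrow> f x} \<subseteq> N"
    using s(2) by (auto simp: eventually_ae_filter)
  define g where "g x = (if x \<in> N then 0 else f x)" for x
  have "simple_limit M g"
    unfolding simple_limit_def
  proof (intro exI[of _ "\<lambda>i x. if x \<in> N then 0 else s i x"] conjI allI ballI)
    fix i
    have "{x \<in> space M. x \<in> N} \<in> sets M"
      using N(1) by (auto simp: Collect_conj_eq)
    then show "simple_function M (\<lambda>x. if x \<in> N then 0 else s i x)"
      by (auto intro!: simple_function_If s)
  next
    fix x assume "x \<in> space M"
    then show "(\<lambda>i. if x \<in> N then 0 else s i x) \<longlonglongrightarrow> g x"
      using N by (auto simp: g_def)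
  qed
  moreover have "AE x in M. f x = g x"
    using AE_not_in[OF N(1)] by eventually_elim (simp add: g_def)
  ultimately show thesis by (rule that)
qed

lemma strongly_measurable_compose2:
  assumes "strongly_measurable M f" "strongly_measurable M g"
    and h: "\<And>s t a b. s \<longlonglongrightarrow> a \<Longrightarrow> t \<longlonglongrightarrow> b \<Longrightarrow> (\<lambda>n. h (s n) (t n)) \<longlonglongrightarrow> h a b"
  shows "strongly_measurable M (\<lambda>x. h (f x) (g x))"
proof -
  obtain f' where f': "simple_limit M f'" "AE x in M. f x = f' x"
    using assms(1) by (rule strongly_measurableE)
  obtain g' where g': "simple_limit M g'" "AE x in M. g x = g' x"
    using assms(2) by (rule strongly_measurableE)
  have "AE x in M. h (f x) (g x) = h (f' x) (g' x)"
    using f'(2) g'(2) by eventually_elim simp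
  moreover have "simple_limit M (\<lambda>x. h (f' x) (g' x))"
    using f'(1) g'(1) h by (rule simple_limit_compose2)
  ultimately show ?thesis
    using strongly_measurable_cong_AE strongly_measurable_simple_limit by metis
qed

lemma strongly_measurable_scaleC:
  fixes f :: "'s \<Rightarrow> 'a::complex_normed_vector"
  assumes "c \<in> borel_measurable M" "strongly_measurable M f"
  shows "strongly_measurable M (\<lambda>x. c x *\<^sub>C f x)"
  by (rule strongly_measurable_compose2[where h = scaleC])
     (auto intro: scaleC.tendsto assms strongly_measurable_simple_limit simple_limit_borel_measurable)

text \<open>Approximants larger than \<open>2 * norm (f x)\<close> are cut to 0. Where
  \<open>f x\<close> is nonzero this stops happening eventually, because 2 > 1; where
  \<open>f x = 0\<close> it forces the approximants to be 0, which is the limit. The bound prepares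
  dominated convergence.\<close>

lemma simple_limit_dominatedE:
  assumes "simple_limit M f"
  obtains s where "\<And>i. simple_function M (s i)" "\<And>x. x \<in> space M \<Longrightarrow> (\<lambda>i. s i x) \<longlonglongrightarrow> f x"
    "\<And>i x. x \<in> space M \<Longrightarrow> norm (s i x) \<le> 2 * norm (f x)"
proof -
  obtain s where s: "\<And>i. simple_function M (s i)" "\<And>x. x \<in> space M \<Longrightarrow> (\<lambda>i. s i x) \<longlonglongrightarrow> f x"
    using assms unfolding simple_limit_def by metis
  note [measurable] = borel_measurable_norm_simple_limit[OF assms]
  have [measurable]: "(\<lambda>x. norm (s i x)) \<in> borel_measurable M" for i
    by (intro borel_measurable_norm_simple_limit simple_limit_simple_function s)
  define t where "t i x = (if norm (s i x) \<le> 2 * norm (f x) then s i x else 0)" for i x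
  show thesis
  proof (rule that[of t])
    show "simple_function M (t i)" for i
      unfolding t_def by (intro simple_function_If s) (simp_all)
    show "norm (t i x) \<le> 2 * norm (f x)" for i x
      by (simp add: t_def)
    fix x assume x: "x \<in> space M"
    show "(\<lambda>i. t i x) \<longlonglongrightarrow> f x"
    proof (cases "f x = 0")
      case True
      then have "t i x = 0" for i by (simp add: t_def)
      with True show ?thesis by simp
    next
      case False
      then have "norm (f x) < 2 * norm (f x)" by simp
      then have "\<forall>\<^sub>F i in sequentially. norm (s i x) < 2 * norm (f x)"
        using tendsto_norm[OF s(2)[OF x]] by (rule order_tendstoD(2)[rotated])
      then have "\<forall>\<^sub>F i in sequentially. s i x = t i x"
        by eventually_elim (simp add: t_def)
      then show ?thesis
        using s(2)[OF x] by (simp add: tendsto_cong)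
    qed
  qed
qed

text \<open>Dominated convergence: approximants bounded by twice the norm of \<open>f\<close> leave
  an error of at most three times that norm, whence the majorant with factor
  \<open>3 powr p\<close>.\<close>

lemma simple_function_Lp_approx:
  fixes p e :: real
  assumes f: "simple_limit M f" and fin: "(\<integral>\<^sup>+ x. ennreal (norm (f x) powr p) \<partial>M) < \<infinity>"
    and p: "p > 0" and e: "e > 0"
  obtains s where "simple_function M s" "(\<integral>\<^sup>+ x. ennreal (norm (f x - s x) powr p) \<partial>M) < ennreal e"
proof -
  obtain s where s: "\<And>i. simple_function M (s i)" "\<And>x. x \<in> space M \<Longrightarrow> (\<lambda>i. s i x) \<longlonglongrightarrow> f x"
    "\<And>i x. x \<in> space M \<Longrightarrow> norm (s i x) \<le> 2 * norm (f x)"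
    using simple_limit_dominatedE[OF f] by metis
  note [measurable] = borel_measurable_norm_simple_limit[OF f]
  have [measurable]: "(\<lambda>x. norm (f x - s i x)) \<in> borel_measurable M" for i
    by (intro borel_measurable_norm_simple_limit simple_limit_diff f simple_limit_simple_function s)
  have "(\<lambda>i. \<integral>\<^sup>+ x. ennreal (norm (f x - s i x) powr p) \<partial>M) \<longlonglongrightarrow> (\<integral>\<^sup>+ x. 0 \<partial>M)"
  proof (rule nn_integral_dominated_convergence)
    show "AE x in M. ennreal (norm (f x - s i x) powr p) \<le> ennreal (3 powr p) * ennreal (norm (f x) powr p)" for i
    proof (rule AE_I2)
      fix x assume x: "x \<in> space M"
      have "norm (f x - s i x) \<le> 3 * norm (f x)"
        using norm_triangle_ineq4[of "f x" "s i x"] s(3)[OF x, of i] by simp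
      then have "norm (f x - s i x) powr p \<le> (3 * norm (f x)) powr p"
        using p by (intro powr_mono2) auto
      then show "ennreal (norm (f x - s i x) powr p) \<le> ennreal (3 powr p) * ennreal (norm (f x) powr p)"
        by (simp add: powr_mult ennreal_mult[symmetric] ennreal_leI)
    qed
    show "(\<integral>\<^sup>+ x. ennreal (3 powr p) * ennreal (norm (f x) powr p) \<partial>M) < \<infinity>"
      using fin by (simp add: nn_integral_cmult ennreal_mult_less_top)
    show "AE x in M. (\<lambda>i. ennreal (norm (f x - s i x) powr p)) \<longlonglongrightarrow> 0"
    proof (rule AE_I2)
      fix x assume x: "x \<in> space M"
      have "(\<lambda>i. norm (f x - s i x)) \<longlonglongrightarrow> norm (f x - f x)"
        by (intro tendsto_intros s x)
      then have "(\<lambda>i. norm (f x - s i x) powr p) \<longlonglongrightarrow> 0 powr p"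
        using p by (intro tendsto_powr') (auto intro: tendsto_intros)
      then show "(\<lambda>i. ennreal (norm (f x - s i x) powr p)) \<longlonglongrightarrow> 0"
        using p by (simp add: tendsto_ennrealI flip: ennreal_0)
    qed
  qed auto
  then have "\<forall>\<^sub>F i in sequentially. (\<integral>\<^sup>+ x. ennreal (norm (f x - s i x) powr p) \<partial>M) < ennreal e"
    using e by (intro order_tendstoD(2)) auto
  then obtain i where "(\<integral>\<^sup>+ x. ennreal (norm (f x - s i x) powr p) \<partial>M) < ennreal e"
    by (auto simp: eventually_sequentially)
  with s(1) show thesis by (rule that)
qed

section \<open>Existence and uniqueness of the Bochner integral\<close>

lemma (in finite_measure) simple_bochner_integrable_simple_function:
  "simple_function M s \<Longrightarrow> Bochner_Integration.simple_bochner_integrable M s"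
  by (rule Bochner_Integration.simple_bochner_integrable.intros) auto

text \<open>The path s, f, g, t splits \<open>s x - t x\<close> into three differences. With
  distinct \<open>f\<close> and \<open>g\<close> this compares two integrals in the limit; with
  \<open>f = g\<close> it shows that integrals of approximants form a Cauchy sequence.\<close>

lemma (in finite_measure) simple_bochner_integral_norm_diff_le:
  fixes f :: "'a \<Rightarrow> 'b::real_normed_vector"
  assumes f: "strongly_measurable M f" and g: "strongly_measurable M g"
    and s: "simple_function M s" and t: "simple_function M t"
  shows "ennreal (norm (Bochner_Integration.simple_bochner_integral M s
             - Bochner_Integration.simple_bochner_integral M t))
    \<le> (\<integral>\<^sup>+ x. ennreal (norm (f x - s x)) \<partial>M) + (\<integral>\<^sup>+ x. ennreal (norm (f x - g x)) \<partial>M)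
       + (\<integral>\<^sup>+ x. ennreal (norm (g x - t x)) \<partial>M)"
proof -
  let ?I = "Bochner_Integration.simple_bochner_integral M"
  obtain f' where f': "simple_limit M f'" "AE x in M. f x = f' x"
    using f by (rule strongly_measurableE)
  obtain g' where g': "simple_limit M g'" "AE x in M. g x = g' x"
    using g by (rule strongly_measurableE)
  note sl = f'(1) g'(1) simple_limit_simple_function[OF s] simple_limit_simple_function[OF t]
  have [measurable]: "(\<lambda>x. norm (f' x - s x)) \<in> borel_measurable M"
    "(\<lambda>x. norm (f' x - g' x)) \<in> borel_measurable M" "(\<lambda>x. norm (g' x - t x)) \<in> borel_measurable M"
    by (intro borel_measurable_norm_simple_limit simple_limit_diff sl)+
  note int = simple_bochner_integrable_simple_function
  have st: "simple_function M (\<lambda>x. s x - t x)"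
    by (rule simple_function_compose2[OF s t])
  have "norm (?I s - ?I t) = norm (?I (\<lambda>x. s x - t x))"
    by (simp add: simple_bochner_integral_diff int s t)
  also have "\<dots> \<le> Bochner_Integration.simple_bochner_integral M (\<lambda>x. norm (s x - t x))"
    by (intro simple_bochner_integral_norm_bound int st)
  finally have "ennreal (norm (?I s - ?I t)) \<le>
      ennreal (Bochner_Integration.simple_bochner_integral M (\<lambda>x. norm (s x - t x)))"
    by (rule ennreal_leI)
  also have "\<dots> = (\<integral>\<^sup>+ x. ennreal (norm (s x - t x)) \<partial>M)"
    by (intro simple_bochner_integral_eq_nn_integral int simple_function_compose1[OF st]) auto
  also have "\<dots> \<le> (\<integral>\<^sup>+ x. (ennreal (norm (f' x - s x)) + ennreal (norm (f' x - g' x))) + ennreal (norm (g' x - t x)) \<partial>M)"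
  proof (intro nn_integral_mono)
    fix x
    have "norm (s x - t x) \<le> norm (f' x - s x) + norm (f' x - g' x) + norm (g' x - t x)"
      by norm
    then show "ennreal (norm (s x - t x))
        \<le> ennreal (norm (f' x - s x)) + ennreal (norm (f' x - g' x)) + ennreal (norm (g' x - t x))"
      by (simp add: ennreal_leI flip: ennreal_plus)
  qed
  also have "\<dots> = (\<integral>\<^sup>+ x. ennreal (norm (f' x - s x)) \<partial>M) + (\<integral>\<^sup>+ x. ennreal (norm (f' x - g' x)) \<partial>M)
       + (\<integral>\<^sup>+ x. ennreal (norm (g' x - t x)) \<partial>M)"
    by (simp add: nn_integral_add)
  also have "(\<integral>\<^sup>+ x. ennreal (norm (f' x - s x)) \<partial>M) = (\<integral>\<^sup>+ x. ennreal (norm (f x - s x)) \<partial>M)"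
    using f'(2) by (intro nn_integral_cong_AE) (auto elim: eventually_mono)
  also have "(\<integral>\<^sup>+ x. ennreal (norm (g' x - t x)) \<partial>M) = (\<integral>\<^sup>+ x. ennreal (norm (g x - t x)) \<partial>M)"
    using g'(2) by (intro nn_integral_cong_AE) (auto elim: eventually_mono)
  also have "(\<integral>\<^sup>+ x. ennreal (norm (f' x - g' x)) \<partial>M) = (\<integral>\<^sup>+ x. ennreal (norm (f x - g x)) \<partial>M)"
    using f'(2) g'(2) by (intro nn_integral_cong_AE) (auto elim: eventually_elim2)
  finally show ?thesis .
qed

text \<open>Limit of the previous estimate along approximating sequences. Equal integrands give
  uniqueness of the integral; otherwise it is the L_1 continuity used for Fourier
  coefficients.\<close>

lemma (in finite_measure) has_bochner_int_norm_diff_le: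
  fixes f g :: "'a \<Rightarrow> 'b::real_normed_vector"
  assumes f: "has_bochner_int M f x" and g: "has_bochner_int M g y"
  shows "ennreal (norm (x - y)) \<le> (\<integral>\<^sup>+ z. ennreal (norm (f z - g z)) \<partial>M)"
proof -
  let ?I = "Bochner_Integration.simple_bochner_integral M"
  obtain s where s: "\<And>i. Bochner_Integration.simple_bochner_integrable M (s i)"
    "(\<lambda>i. \<integral>\<^sup>+ y. ennreal (norm (f y - s i y)) \<partial>M) \<longlonglongrightarrow> 0" "(\<lambda>i. ?I (s i)) \<longlonglongrightarrow> x"
    using f unfolding has_bochner_int_def by blast
  obtain t where t: "\<And>i. Bochner_Integration.simple_bochner_integrable M (t i)"
    "(\<lambda>i. \<integral>\<^sup>+ y. ennreal (norm (g y - t i y)) \<partial>M) \<longlonglongrightarrow> 0" "(\<lambda>i. ?I (t i)) \<longlonglongrightarrow> y"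
    using g unfolding has_bochner_int_def by blast
  have "(\<lambda>i. ennreal (norm (?I (s i) - ?I (t i)))) \<longlonglongrightarrow> ennreal (norm (x - y))"
    by (intro tendsto_intros s t)
  moreover have "(\<lambda>i. (\<integral>\<^sup>+ x. ennreal (norm (f x - s i x)) \<partial>M) + (\<integral>\<^sup>+ x. ennreal (norm (f x - g x)) \<partial>M)
       + (\<integral>\<^sup>+ x. ennreal (norm (g x - t i x)) \<partial>M)) \<longlonglongrightarrow> 0 + (\<integral>\<^sup>+ x. ennreal (norm (f x - g x)) \<partial>M) + 0"
    by (intro tendsto_intros s t)
  moreover have "ennreal (norm (?I (s i) - ?I (t i))) \<le> (\<integral>\<^sup>+ x. ennreal (norm (f x - s i x)) \<partial>M)
     + (\<integral>\<^sup>+ x. ennreal (norm (f x - g x)) \<partial>M) + (\<integral>\<^sup>+ x. ennreal (norm (g x - t i x)) \<partial>M)" for i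
    using s(1)[of i] t(1)[of i] f g
    by (intro simple_bochner_integral_norm_diff_le)
       (auto simp: has_bochner_int_def Bochner_Integration.simple_bochner_integrable.simps)
  ultimately show ?thesis
    using LIMSEQ_le[of "\<lambda>i. ennreal (norm (?I (s i) - ?I (t i)))" "ennreal (norm (x - y))"] by simp
qed

lemma (in finite_measure) bochner_int_eqI:
  assumes "has_bochner_int M f x"
  shows "bochner_int M f = x"
proof -
  have *: "y = x" if "has_bochner_int M f y" for y
    using has_bochner_int_norm_diff_le[OF that assms] by simp
  have "(THE x. has_bochner_int M f x) = x"
    using assms by (rule the_equality) (rule *)
  then show ?thesis
    using assms unfolding bochner_int_def by auto
qed

text \<open>Bochner's criterion; on a finite measure space
  \<open>has_bochner_int_bochner_int\<close> derives the existence of the integral from it.\<close>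

definition bochner_integrable :: "'s measure \<Rightarrow> ('s \<Rightarrow> 'a::real_normed_vector) \<Rightarrow> bool" where
  "bochner_integrable M f \<longleftrightarrow> strongly_measurable M f \<and> (\<integral>\<^sup>+ x. ennreal (norm (f x)) \<partial>M) < \<infinity>"

lemma nn_integral_norm_cong_AE:
  "AE x in M. f x = g x \<Longrightarrow> (\<integral>\<^sup>+ x. ennreal (norm (f x)) \<partial>M) = (\<integral>\<^sup>+ x. ennreal (norm (g x)) \<partial>M)"
  by (intro nn_integral_cong_AE) (auto elim: eventually_mono)

lemma bochner_integrable_cong_AE:
  "AE x in M. f x = g x \<Longrightarrow> bochner_integrable M f \<longleftrightarrow> bochner_integrable M g"
  unfolding bochner_integrable_def
  using strongly_measurable_cong_AE nn_integral_norm_cong_AE by metis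

lemma has_bochner_int_cong_AE:
  assumes "AE x in M. f x = g x"
  shows "has_bochner_int M f y \<longleftrightarrow> has_bochner_int M g y"
proof -
  have "(\<integral>\<^sup>+ x. ennreal (norm (f x - s x)) \<partial>M) = (\<integral>\<^sup>+ x. ennreal (norm (g x - s x)) \<partial>M)" for s
    using assms by (intro nn_integral_cong_AE) (auto elim: eventually_mono)
  then show ?thesis
    unfolding has_bochner_int_def using strongly_measurable_cong_AE[OF assms] by simp
qed

lemma bochner_int_cong_AE:
  assumes "AE x in M. f x = g x"
  shows "bochner_int M f = bochner_int M g"
proof -
  have "has_bochner_int M f = has_bochner_int M g"
    using has_bochner_int_cong_AE[OF assms] by (intro ext)
  then show ?thesis
    by (simp add: bochner_int_def)
qed

lemma bochner_integrableE:
  assumes "bochner_integrable M f"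
  obtains g where "simple_limit M g" "AE x in M. f x = g x" "(\<integral>\<^sup>+ x. ennreal (norm (g x)) \<partial>M) < \<infinity>"
proof -
  obtain g where g: "simple_limit M g" "AE x in M. f x = g x"
    using assms strongly_measurableE unfolding bochner_integrable_def by metis
  then show thesis
    using that assms nn_integral_norm_cong_AE[OF g(2)] unfolding bochner_integrable_def by metis
qed

lemma bochner_integrable_simple_approx:
  assumes "bochner_integrable M f" "e > 0"
  obtains s where "simple_function M s" "(\<integral>\<^sup>+ x. ennreal (norm (f x - s x)) \<partial>M) < ennreal e"
proof -
  obtain g where g: "simple_limit M g" "AE x in M. f x = g x" "(\<integral>\<^sup>+ x. ennreal (norm (g x)) \<partial>M) < \<infinity>"
    using assms(1) by (rule bochner_integrableE)
  obtain s where s: "simple_function M s" "(\<integral>\<^sup>+ x. ennreal (norm (g x - s x)) \<partial>M) < ennreal e"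
    using simple_function_Lp_approx[OF g(1), of 1 e] g(3) assms(2) by auto
  have "(\<integral>\<^sup>+ x. ennreal (norm (f x - s x)) \<partial>M) = (\<integral>\<^sup>+ x. ennreal (norm (g x - s x)) \<partial>M)"
    using g(2) by (intro nn_integral_cong_AE) (auto elim: eventually_mono)
  with s show thesis using that by metis
qed

text \<open>Integrals of simple approximants differ by at most the sum of their L_1 errors, so they
  converge by completeness of the target space.\<close>

lemma (in finite_measure) has_bochner_int_bochner_int:
  fixes f :: "'a \<Rightarrow> 'b::banach"
  assumes "bochner_integrable M f"
  shows "has_bochner_int M f (bochner_int M f)"
proof -
  let ?I = "Bochner_Integration.simple_bochner_integral M"
  have f: "strongly_measurable M f"
    using assms by (simp add: bochner_integrable_def)
  have "\<exists>s. \<forall>n. simple_function M (s n) \<and>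
      (\<integral>\<^sup>+ x. ennreal (norm (f x - s n x)) \<partial>M) < ennreal (inverse (real (Suc n)))"
    using bochner_integrable_simple_approx[OF assms]
    by (intro choice allI) (metis inverse_positive_iff_positive of_nat_0_less_iff zero_less_Suc)
  then obtain s where s: "\<And>n. simple_function M (s n)"
    "\<And>n. (\<integral>\<^sup>+ x. ennreal (norm (f x - s n x)) \<partial>M) < ennreal (inverse (real (Suc n)))"
    by blast
  \<comment> \<open>The difference estimate is used with \<open>g = f\<close>, so its middle term is
    0.\<close>
  have bd: "norm (?I (s m) - ?I (s n)) \<le> inverse (real (Suc m)) + inverse (real (Suc n))" for m n
  proof -
    have "ennreal (norm (?I (s m) - ?I (s n))) \<le> (\<integral>\<^sup>+ x. ennreal (norm (f x - s m x)) \<partial>M)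
        + (\<integral>\<^sup>+ x. ennreal (norm (f x - f x)) \<partial>M) + (\<integral>\<^sup>+ x. ennreal (norm (f x - s n x)) \<partial>M)"
      by (intro simple_bochner_integral_norm_diff_le f s)
    also have "\<dots> \<le> ennreal (inverse (real (Suc m))) + 0 + ennreal (inverse (real (Suc n)))"
      using s(2)[of m] s(2)[of n] by (intro add_mono) auto
    also have "\<dots> = ennreal (inverse (real (Suc m)) + inverse (real (Suc n)))"
      by simp
    finally show ?thesis
      by (subst (asm) ennreal_le_iff) auto
  qed
  have "Cauchy (\<lambda>n. ?I (s n))"
  proof (rule metric_CauchyI)
    fix e :: real assume "e > 0"
    then obtain N where N: "inverse (real (Suc N)) < e / 2"
      using reals_Archimedean half_gt_zero by blast
    have "dist (?I (s m)) (?I (s n)) < e" if "m \<ge> N" "n \<ge> N" for m n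
    proof -
      have "inverse (real (Suc m)) \<le> inverse (real (Suc N))" "inverse (real (Suc n)) \<le> inverse (real (Suc N))"
        using that by auto
      then show ?thesis
        using bd[of m n] N unfolding dist_norm by linarith
    qed
    then show "\<exists>N. \<forall>m\<ge>N. \<forall>n\<ge>N. dist (?I (s m)) (?I (s n)) < e"
      by blast
  qed
  then obtain y where y: "(\<lambda>n. ?I (s n)) \<longlonglongrightarrow> y"
    using Cauchy_convergent convergent_def by blast
  have "(\<lambda>n. \<integral>\<^sup>+ x. ennreal (norm (f x - s n x)) \<partial>M) \<longlonglongrightarrow> 0"
  proof (rule tendsto_sandwich[OF _ _ tendsto_const])
    show "(\<lambda>n. ennreal (inverse (real (Suc n)))) \<longlonglongrightarrow> 0"
      using tendsto_ennrealI[OF LIMSEQ_inverse_real_of_nat] by simp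
    show "\<forall>\<^sub>F n in sequentially. (\<integral>\<^sup>+ x. ennreal (norm (f x - s n x)) \<partial>M) \<le> ennreal (inverse (real (Suc n)))"
      using s(2) by (auto intro: always_eventually less_imp_le)
  qed auto
  then have "has_bochner_int M f y"
    unfolding has_bochner_int_def
    using f y s(1) simple_bochner_integrable_simple_function by blast
  then show ?thesis
    using bochner_int_eqI by metis
qed

section \<open>Linearity of the Bochner integral\<close>

lemma has_bochner_int_add:
  assumes f: "has_bochner_int M f x" and g: "has_bochner_int M g y"
  shows "has_bochner_int M (\<lambda>z. f z + g z) (x + y)"
proof -
  let ?I = "Bochner_Integration.simple_bochner_integral M"
  obtain s where s: "\<And>i. Bochner_Integration.simple_bochner_integrable M (s i)"
    "(\<lambda>i. \<integral>\<^sup>+ y. ennreal (norm (f y - s i y)) \<partial>M) \<longlonglongrightarrow> 0" "(\<lambda>i. ?I (s i)) \<longlonglongrightarrow> x"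
    using f unfolding has_bochner_int_def by blast
  obtain t where t: "\<And>i. Bochner_Integration.simple_bochner_integrable M (t i)"
    "(\<lambda>i. \<integral>\<^sup>+ y. ennreal (norm (g y - t i y)) \<partial>M) \<longlonglongrightarrow> 0" "(\<lambda>i. ?I (t i)) \<longlonglongrightarrow> y"
    using g unfolding has_bochner_int_def by blast
  obtain f' where f': "simple_limit M f'" "AE x in M. f x = f' x"
    using f strongly_measurableE unfolding has_bochner_int_def by metis
  obtain g' where g': "simple_limit M g'" "AE x in M. g x = g' x"
    using g strongly_measurableE unfolding has_bochner_int_def by metis
  have sm: "strongly_measurable M (\<lambda>z. f z + g z)"
    using f g unfolding has_bochner_int_def
    by (intro strongly_measurable_compose2[where h = "(+)"]) (auto intro: tendsto_add)
  have le: "(\<integral>\<^sup>+ z. ennreal (norm (f z + g z - (s i z + t i z))) \<partial>M)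
     \<le> (\<integral>\<^sup>+ z. ennreal (norm (f z - s i z)) \<partial>M) + (\<integral>\<^sup>+ z. ennreal (norm (g z - t i z)) \<partial>M)" for i
  proof -
    have st: "simple_limit M (s i)" "simple_limit M (t i)"
      using s(1)[of i] t(1)[of i]
      by (auto simp: Bochner_Integration.simple_bochner_integrable.simps simple_limit_simple_function)
    have [measurable]: "(\<lambda>x. norm (f' x - s i x)) \<in> borel_measurable M"
      "(\<lambda>x. norm (g' x - t i x)) \<in> borel_measurable M"
      by (intro borel_measurable_norm_simple_limit simple_limit_diff st f' g')+
    have "(\<integral>\<^sup>+ z. ennreal (norm (f z + g z - (s i z + t i z))) \<partial>M)
        \<le> (\<integral>\<^sup>+ z. ennreal (norm (f' z - s i z)) + ennreal (norm (g' z - t i z)) \<partial>M)"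
    proof (intro nn_integral_mono_AE)
      show "AE z in M. ennreal (norm (f z + g z - (s i z + t i z)))
          \<le> ennreal (norm (f' z - s i z)) + ennreal (norm (g' z - t i z))"
        using f'(2) g'(2)
      proof eventually_elim
        case (elim z)
        have "norm (f z + g z - (s i z + t i z)) \<le> norm (f' z - s i z) + norm (g' z - t i z)"
          unfolding elim by (rule norm_diff_triangle_ineq)
        then show ?case
          by (simp add: ennreal_leI flip: ennreal_plus)
      qed
    qed
    also have "\<dots> = (\<integral>\<^sup>+ z. ennreal (norm (f' z - s i z)) \<partial>M) + (\<integral>\<^sup>+ z. ennreal (norm (g' z - t i z)) \<partial>M)"
      by (simp add: nn_integral_add)
    also have "(\<integral>\<^sup>+ x. ennreal (norm (f' x - s i x)) \<partial>M) = (\<integral>\<^sup>+ x. ennreal (norm (f x - s i x)) \<partial>M)"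
      using f'(2) by (intro nn_integral_cong_AE) (auto elim: eventually_mono)
    also have "(\<integral>\<^sup>+ x. ennreal (norm (g' x - t i x)) \<partial>M) = (\<integral>\<^sup>+ x. ennreal (norm (g x - t i x)) \<partial>M)"
      using g'(2) by (intro nn_integral_cong_AE) (auto elim: eventually_mono)
    finally show ?thesis .
  qed
  have "(\<lambda>i. (\<integral>\<^sup>+ z. ennreal (norm (f z - s i z)) \<partial>M) + (\<integral>\<^sup>+ z. ennreal (norm (g z - t i z)) \<partial>M)) \<longlonglongrightarrow> 0"
    using tendsto_add[OF s(2) t(2)] by simp
  then have "(\<lambda>i. \<integral>\<^sup>+ z. ennreal (norm (f z + g z - (s i z + t i z))) \<partial>M) \<longlonglongrightarrow> 0"
    by (rule tendsto_sandwich[OF _ _ tendsto_const, rotated 2]) (use le in auto)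
  moreover have "(\<lambda>i. ?I (\<lambda>z. s i z + t i z)) \<longlonglongrightarrow> x + y"
    using tendsto_add[OF s(3) t(3)] by (simp add: simple_bochner_integral_add s t)
  moreover have "Bochner_Integration.simple_bochner_integrable M (\<lambda>z. s i z + t i z)" for i
    by (rule simple_bochner_integrable_compose2[where p = "(+)", OF _ s(1) t(1)]) simp
  ultimately show ?thesis
    unfolding has_bochner_int_def using sm by (intro conjI exI[of _ "\<lambda>i z. s i z + t i z"]) auto
qed

lemma has_bochner_int_bounded_linear:
  assumes "bounded_linear T" and f: "has_bochner_int M f x"
  shows "has_bochner_int M (\<lambda>z. T (f z)) (T x)"
proof -
  interpret T: bounded_linear T by fact
  let ?I = "Bochner_Integration.simple_bochner_integral M"
  obtain s where s: "\<And>i. Bochner_Integration.simple_bochner_integrable M (s i)"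
    "(\<lambda>i. \<integral>\<^sup>+ y. ennreal (norm (f y - s i y)) \<partial>M) \<longlonglongrightarrow> 0" "(\<lambda>i. ?I (s i)) \<longlonglongrightarrow> x"
    using f unfolding has_bochner_int_def by blast
  obtain f' where f': "simple_limit M f'" "AE x in M. f x = f' x"
    using f strongly_measurableE unfolding has_bochner_int_def by metis
  have sm: "strongly_measurable M (\<lambda>z. T (f z))"
    using f unfolding has_bochner_int_def
    by (intro strongly_measurable_compose2[where h = "\<lambda>a b. T a" and g = f]) (auto intro: T.tendsto)
  obtain K where K: "\<And>x. norm (T x) \<le> norm x * K" "K > 0"
    using T.pos_bounded by blast
  have le: "(\<integral>\<^sup>+ z. ennreal (norm (T (f z) - T (s i z))) \<partial>M)
     \<le> (\<integral>\<^sup>+ z. ennreal (norm (f z - s i z)) \<partial>M) * ennreal K" for i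
  proof -
    have st: "simple_limit M (s i)"
      using s(1)[of i]
      by (auto simp: Bochner_Integration.simple_bochner_integrable.simps simple_limit_simple_function)
    have [measurable]: "(\<lambda>x. norm (f' x - s i x)) \<in> borel_measurable M"
      by (intro borel_measurable_norm_simple_limit simple_limit_diff st f')
    have "(\<integral>\<^sup>+ z. ennreal (norm (T (f z) - T (s i z))) \<partial>M)
        \<le> (\<integral>\<^sup>+ z. ennreal (norm (f' z - s i z)) * ennreal K \<partial>M)"
    proof (intro nn_integral_mono_AE)
      show "AE z in M. ennreal (norm (T (f z) - T (s i z))) \<le> ennreal (norm (f' z - s i z)) * ennreal K"
        using f'(2)
      proof eventually_elim
        case (elim z)
        have "norm (T (f z) - T (s i z)) \<le> norm (f' z - s i z) * K"
          unfolding elim T.diff[symmetric] by (rule K)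
        then show ?case
          using K(2) by (simp add: ennreal_leI flip: ennreal_mult)
      qed
    qed
    also have "\<dots> = (\<integral>\<^sup>+ z. ennreal (norm (f' z - s i z)) \<partial>M) * ennreal K"
      by (simp add: nn_integral_multc)
    also have "(\<integral>\<^sup>+ x. ennreal (norm (f' x - s i x)) \<partial>M) = (\<integral>\<^sup>+ x. ennreal (norm (f x - s i x)) \<partial>M)"
      using f'(2) by (intro nn_integral_cong_AE) (auto elim: eventually_mono)
    finally show ?thesis .
  qed
  have "(\<lambda>i. (\<integral>\<^sup>+ z. ennreal (norm (f z - s i z)) \<partial>M) * ennreal K) \<longlonglongrightarrow> 0"
    using ennreal_tendsto_cmult[OF _ s(2), of "ennreal K"] by (simp add: mult.commute)
  then have "(\<lambda>i. \<integral>\<^sup>+ z. ennreal (norm (T (f z) - T (s i z))) \<partial>M) \<longlonglongrightarrow> 0"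
    by (rule tendsto_sandwich[OF _ _ tendsto_const, rotated 2]) (use le in auto)
  moreover have "(\<lambda>i. Bochner_Integration.simple_bochner_integral M (\<lambda>z. T (s i z))) \<longlonglongrightarrow> T x"
    using T.tendsto[OF s(3)]
    by (simp add: simple_bochner_integral_linear T.linear_axioms s)
  moreover have "Bochner_Integration.simple_bochner_integrable M (\<lambda>z. T (s i z))" for i
    by (rule simple_bochner_integrable_compose2[where p = "\<lambda>a b. T a", OF _ s(1) s(1)]) (simp add: T.zero)
  ultimately show ?thesis
    unfolding has_bochner_int_def using sm by (intro conjI exI[of _ "\<lambda>i z. T (s i z)"]) auto
qed

lemma has_bochner_int_zero: "has_bochner_int M (\<lambda>z. 0) 0"
proof -
  have "Bochner_Integration.simple_bochner_integral M (\<lambda>z. 0) = (0 :: 'b)"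
    unfolding Bochner_Integration.simple_bochner_integral_def by (intro sum.neutral) auto
  then show ?thesis
    unfolding has_bochner_int_def
    by (intro conjI exI[of _ "\<lambda>i z. 0"] strongly_measurable_simple_limit simple_limit_const)
       (auto simp: Bochner_Integration.simple_bochner_integrable.simps)
qed

lemma has_bochner_int_sum:
  assumes "\<And>i. i \<in> I \<Longrightarrow> has_bochner_int M (f i) (x i)"
  shows "has_bochner_int M (\<lambda>z. \<Sum>i\<in>I. f i z) (\<Sum>i\<in>I. x i)"
  using assms
  by (induction I rule: infinite_finite_induct) (auto intro: has_bochner_int_zero has_bochner_int_add)

text \<open>Scalar integrals are computed with the library's integral and imported here; composing
  with the bounded linear map that sends a scalar c to \<open>c *\<^sub>C x\<close> then yields
  integrals with values in an arbitrary Banach space.\<close>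

lemma has_bochner_int_has_bochner_integral:
  assumes "has_bochner_integral M f x"
  shows "has_bochner_int M f x"
  using assms
proof cases
  case (1 s)
  then show ?thesis
    unfolding has_bochner_int_def
    using strongly_measurable_simple_limit[OF simple_limit_borel_measurable[OF 1(1)]]
    by (intro conjI exI[of _ s]) auto
qed

section \<open>Monomials on the infinite torus\<close>

definition torus :: "(nat \<Rightarrow> complex) set" where
  "torus = {z. \<forall>k. cmod (z k) = 1}"

lemma space_torus_measure: "space torus_measure = torus"
  by (auto simp: torus_measure_def space_PiM space_circle_measure torus_def PiE_iff extensional_def)

lemma torus_nonzero: "z \<in> torus \<Longrightarrow> z k \<noteq> 0"
  unfolding torus_def by (metis (mono_tags) mem_Collect_eq norm_zero zero_neq_one)

lemma compact_torus: "compact torus"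
proof -
  have "torus = PiE UNIV (\<lambda>_. sphere 0 1)"
    by (auto simp: torus_def PiE_iff extensional_def)
  moreover have "compactin (product_topology (\<lambda>_::nat. euclidean) UNIV) (PiE UNIV (\<lambda>_. sphere (0::complex) 1))"
    unfolding compactin_PiE by simp
  ultimately show ?thesis
    by (simp add: euclidean_product_topology)
qed

lemma measurable_id_circle: "(\<lambda>z. z) \<in> borel_measurable circle_measure"
proof -
  have "(\<lambda>z::complex. z) \<in> restrict_space borel (sphere 0 1) \<rightarrow>\<^sub>M borel"
    by (intro measurable_restrict_space1 measurable_ident_sets refl)
  moreover have "sets circle_measure = sets (restrict_space borel (sphere 0 1))"
    by (simp add: circle_measure_def)
  ultimately show ?thesis
    using measurable_cong_sets by blast
qed

lemma measurable_cis: "cis \<in> uniform_measure lborel {0..2 * pi} \<rightarrow>\<^sub>M restrict_space borel (sphere 0 1)"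
proof -
  have "cis \<in> borel_measurable borel"
    by (intro borel_measurable_continuous_onI) (auto intro: continuous_intros)
  then show ?thesis
    by (intro measurable_restrict_space2) (auto simp: measurable_def)
qed

text \<open>Only countably many coordinates occur, so the product sigma-algebra contains the traces
  of all Borel sets of the product topology. This is why continuous functions on the torus are
  measurable.\<close>

lemma measurable_id_torus: "(\<lambda>z. z) \<in> torus_measure \<rightarrow>\<^sub>M restrict_space borel torus"
proof (rule measurable_restrict_space2)
  show "(\<lambda>z. z) \<in> borel_measurable torus_measure"
  proof (rule measurable_coordinatewise_then_product)
    fix k
    have "(\<lambda>z. z k) \<in> torus_measure \<rightarrow>\<^sub>M circle_measure"
      unfolding torus_measure_def by (rule measurable_component_singleton) simp
    then show "(\<lambda>z. z k) \<in> borel_measurable torus_measure"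
      using measurable_id_circle by (rule measurable_compose)
  qed
qed (auto simp: space_torus_measure)

lemma borel_measurable_continuous_on_torus:
  assumes "continuous_on torus f"
  shows "f \<in> borel_measurable torus_measure"
  using measurable_compose[OF measurable_id_torus borel_measurable_continuous_on_restrict[OF assms]] .

text \<open>The index set in \<open>monomial\<close> depends on the exponent; extra factors have
  exponent 0, so several monomials can be written over one common finite set.\<close>

lemma monomial_superset:
  assumes "finite K" "{k. \<alpha> k \<noteq> 0} \<subseteq> K"
  shows "monomial z \<alpha> = (\<Prod>k\<in>K. z k powi \<alpha> k)"
  unfolding monomial_def using assms by (intro prod.mono_neutral_left) auto

lemma int_multi_indices_add:
  "\<alpha> \<in> int_multi_indices \<Longrightarrow> \<beta> \<in> int_multi_indices \<Longrightarrow> (\<lambda>k. \<alpha> k + \<beta> k) \<in> int_multi_indices"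
  unfolding int_multi_indices_def
  by (auto intro: finite_subset[of _ "{k. \<alpha> k \<noteq> 0} \<union> {k. \<beta> k \<noteq> 0}"])

lemma int_multi_indices_uminus: "\<alpha> \<in> int_multi_indices \<Longrightarrow> (\<lambda>k. - \<alpha> k) \<in> int_multi_indices"
  by (simp add: int_multi_indices_def)

lemma int_multi_indices_zero: "(\<lambda>k. 0) \<in> int_multi_indices"
  by (simp add: int_multi_indices_def)

lemma int_multi_indices_single: "(\<lambda>k. if k = j then n else 0) \<in> int_multi_indices"
  by (auto simp: int_multi_indices_def intro: finite_subset[of _ "{j}"])

lemma monomial_add:
  assumes "z \<in> torus" "\<alpha> \<in> int_multi_indices" "\<beta> \<in> int_multi_indices"
  shows "monomial z (\<lambda>k. \<alpha> k + \<beta> k) = monomial z \<alpha> * monomial z \<beta>"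
proof -
  let ?K = "{k. \<alpha> k \<noteq> 0} \<union> {k. \<beta> k \<noteq> 0}"
  have K: "finite ?K"
    using assms by (auto simp: int_multi_indices_def)
  have "monomial z (\<lambda>k. \<alpha> k + \<beta> k) = (\<Prod>k\<in>?K. z k powi (\<alpha> k + \<beta> k))"
    by (rule monomial_superset[OF K]) auto
  also have "\<dots> = (\<Prod>k\<in>?K. z k powi \<alpha> k * z k powi \<beta> k)"
    by (simp add: power_int_add torus_nonzero[OF assms(1)])
  also have "\<dots> = monomial z \<alpha> * monomial z \<beta>"
    using monomial_superset[OF K, of \<alpha>] monomial_superset[OF K, of \<beta>]
    by (simp add: prod.distrib)
  finally show ?thesis .
qed

lemma norm_monomial: "z \<in> torus \<Longrightarrow> cmod (monomial z \<alpha>) = 1"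
  by (simp add: monomial_def torus_def norm_power_int flip: prod_norm)

lemma monomial_zero: "monomial z (\<lambda>k. 0) = 1"
  by (simp add: monomial_def)

lemma monomial_single: "monomial z (\<lambda>k. if k = j then n else 0) = z j powi n"
  by (subst monomial_superset[of "{j}"]) auto

lemma continuous_on_monomial: "continuous_on torus (\<lambda>z. monomial z \<alpha>)"
  unfolding monomial_def
  by (intro continuous_on_prod continuous_on_power_int continuous_on_subset[OF continuous_on_product_coordinates])
     (auto dest: torus_nonzero)

lemma borel_measurable_monomial: "(\<lambda>z. monomial z \<alpha>) \<in> borel_measurable torus_measure"
  by (intro borel_measurable_continuous_on_torus continuous_on_monomial)

section \<open>Mean values of monomials\<close>

lemma borel_measurable_powi_circle: "(\<lambda>z. z powi n) \<in> borel_measurable circle_measure"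
proof -
  note [measurable] = measurable_id_circle
  show ?thesis
    unfolding power_int_def by (cases "n \<ge> 0") simp_all
qed

text \<open>Pulled back to the interval from 0 to 2 pi, the integrand has for n nonzero the
  antiderivative \<open>cis (n * t) / (2 pi i n)\<close>, which takes the same value at both
  ends.\<close>

lemma integral_powi_circle: "(\<integral>z. z powi n \<partial>circle_measure) = (if n = 0 then 1 else 0)"
proof -
  interpret prob_space circle_measure by (rule prob_space_circle_measure)
  show ?thesis
  proof (cases "n = 0")
    case True
    then show ?thesis by (simp add: prob_space)
  next
    case False
    have dens: "uniform_measure lborel {0..2 * pi} =
        density lborel (\<lambda>t. ennreal (indicator {0..2 * pi} t / (2 * pi)))"
      unfolding uniform_measure_def by (simp add: divide_ennreal flip: ennreal_indicator)
    have cis': "(\<lambda>t. cis (of_int n * t)) \<in> borel_measurable borel"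
      by (intro borel_measurable_continuous_onI) (auto intro!: continuous_intros)
    have powi: "(\<lambda>z::complex. z powi n) \<in> borel_measurable (restrict_space borel (sphere 0 1))"
      using borel_measurable_powi_circle unfolding circle_measure_def by simp
    have "(\<integral>z. z powi n \<partial>circle_measure) = (\<integral>t. cis (of_int n * t) \<partial>uniform_measure lborel {0..2 * pi})"
      unfolding circle_measure_def
      by (subst integral_distr[OF measurable_cis powi]) (simp add: cis_power_int)
    also have "\<dots> = (\<integral>t. (indicator {0..2 * pi} t / (2 * pi)) *\<^sub>R cis (of_int n * t) \<partial>lborel)"
      unfolding dens using cis' by (intro integral_density) auto
    also have "\<dots> = (\<integral>t. indicator {0..2 * pi} t *\<^sub>R (cis (of_int n * t) / of_real (2 * pi)) \<partial>lborel)"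
      by (intro Bochner_Integration.integral_cong) (auto simp: scaleR_conv_of_real)
    also have "\<dots> = cis (of_int n * (2 * pi)) / (\<i> * of_int n * of_real (2 * pi))
         - cis (of_int n * 0) / (\<i> * of_int n * of_real (2 * pi))"
    proof (rule integral_FTC_atLeastAtMost)
      fix x :: real
      have "((\<lambda>t. cis (of_int n * t)) has_vector_derivative of_int n *\<^sub>R (\<i> * cis (of_int n * x))) (at x within {0..2 * pi})"
        unfolding has_vector_derivative_def
        by (rule has_derivative_eq_rhs, rule has_derivative_cis)
           (auto intro!: derivative_eq_intros simp: scaleR_conv_of_real)
      from has_vector_derivative_divide[OF this, of "\<i> * of_int n * of_real (2 * pi)"]
      show "((\<lambda>t. cis (of_int n * t) / (\<i> * of_int n * of_real (2 * pi)))
          has_vector_derivative cis (of_int n * x) / of_real (2 * pi)) (at x within {0..2 * pi})"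
        using False by (simp add: scaleR_conv_of_real field_simps)
    qed (auto intro!: continuous_intros)
    also have "\<dots> = 0"
      using cis_multiple_2pi[of "of_int n"] by (simp add: mult.commute)
    finally show ?thesis using False by simp
  qed
qed

lemma integral_monomial:
  assumes "\<alpha> \<in> int_multi_indices"
  shows "(\<integral>z. monomial z \<alpha> \<partial>torus_measure) = (if \<alpha> = (\<lambda>k. 0) then 1 else 0)"
proof -
  interpret circle: prob_space circle_measure by (rule prob_space_circle_measure)
  interpret product_prob_space "\<lambda>_::nat. circle_measure" UNIV ..
  let ?K = "{k. \<alpha> k \<noteq> 0}"
  have K: "finite ?K"
    using assms by (simp add: int_multi_indices_def)
  note [measurable] = borel_measurable_powi_circle
  have int: "integrable circle_measure (\<lambda>z. z powi n)" for n
    by (rule circle.integrable_const_bound[of _ 1])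
       (auto simp: norm_power_int borel_measurable_powi_circle space_circle_measure intro!: AE_I2)
  \<comment> \<open>Only the coordinates in the support matter; restricting to them replaces the
    infinite product measure by a finite one, on which the integral of a product splits.\<close>
  have "(\<integral>z. monomial z \<alpha> \<partial>torus_measure) = (\<integral>z. (\<Prod>k\<in>?K. restrict z ?K k powi \<alpha> k) \<partial>torus_measure)"
    by (intro Bochner_Integration.integral_cong) (auto simp: monomial_def)
  also have "\<dots> = (\<integral>z. (\<Prod>k\<in>?K. z k powi \<alpha> k) \<partial>distr torus_measure (\<Pi>\<^sub>M k\<in>?K. circle_measure) (\<lambda>z. restrict z ?K))"
    unfolding torus_measure_def
    by (subst integral_distr) (auto intro!: measurable_restrict_subset borel_measurable_prod
      measurable_PiM_component_rev borel_measurable_powi_circle)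
  also have "\<dots> = (\<integral>z. (\<Prod>k\<in>?K. z k powi \<alpha> k) \<partial>(\<Pi>\<^sub>M k\<in>?K. circle_measure))"
    unfolding torus_measure_def using distr_PiM_restrict_finite[OF K] by simp
  also have "\<dots> = (\<Prod>k\<in>?K. \<integral>z. z powi \<alpha> k \<partial>circle_measure)"
    by (intro product_integral_prod K int)
  \<comment> \<open>Exponents in \<open>?K\<close> are nonzero, so each factor vanishes; for
    \<open>\<alpha> = 0\<close> the product is empty and equals 1.\<close>
  also have "\<dots> = (\<Prod>k\<in>?K. 0)"
    by (intro prod.cong) (auto simp: integral_powi_circle)
  also have "\<dots> = (if \<alpha> = (\<lambda>k. 0) then 1 else 0)"
    using K by (auto simp: card_gt_0_iff fun_eq_iff)
  finally show ?thesis .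
qed

section \<open>Trigonometric polynomials\<close>

text \<open>Equality is asked for only on the torus, where \<open>inverse (z k) = cnj (z k)\<close>;
  this is what admits \<open>Re (z k)\<close> and \<open>Im (z k)\<close>.\<close>

definition trig_poly :: "((nat \<Rightarrow> complex) \<Rightarrow> 'a::complex_banach) \<Rightarrow> bool" where
  "trig_poly P \<longleftrightarrow> (\<exists>F c. finite F \<and> F \<subseteq> int_multi_indices \<and>
     (\<forall>z\<in>torus. P z = (\<Sum>\<alpha>\<in>F. monomial z \<alpha> *\<^sub>C c \<alpha>)))"

lemma trig_poly_monomial:
  assumes "\<alpha> \<in> int_multi_indices"
  shows "trig_poly (\<lambda>z. monomial z \<alpha> *\<^sub>C x)"
  unfolding trig_poly_def using assms
  by (intro exI[of _ "{\<alpha>}"] exI[of _ "\<lambda>_. x"]) auto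

lemma trig_poly_const: "trig_poly (\<lambda>z. x)"
  using trig_poly_monomial[OF int_multi_indices_zero, of x] by (simp add: monomial_zero scaleC_one)

lemma trig_poly_cong: "trig_poly P \<Longrightarrow> (\<And>z. z \<in> torus \<Longrightarrow> P z = Q z) \<Longrightarrow> trig_poly Q"
  unfolding trig_poly_def by auto

lemma trig_poly_add:
  assumes "trig_poly P" "trig_poly Q"
  shows "trig_poly (\<lambda>z. P z + Q z)"
proof -
  obtain F c where F: "finite F" "F \<subseteq> int_multi_indices" "\<And>z. z \<in> torus \<Longrightarrow> P z = (\<Sum>\<alpha>\<in>F. monomial z \<alpha> *\<^sub>C c \<alpha>)"
    using assms(1) unfolding trig_poly_def by blast
  obtain G d where G: "finite G" "G \<subseteq> int_multi_indices" "\<And>z. z \<in> torus \<Longrightarrow> Q z = (\<Sum>\<alpha>\<in>G. monomial z \<alpha> *\<^sub>C d \<alpha>)"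
    using assms(2) unfolding trig_poly_def by blast
  define e where "e \<alpha> = (if \<alpha> \<in> F then c \<alpha> else 0) + (if \<alpha> \<in> G then d \<alpha> else 0)" for \<alpha>
  have "P z + Q z = (\<Sum>\<alpha>\<in>F\<union>G. monomial z \<alpha> *\<^sub>C e \<alpha>)" if "z \<in> torus" for z
  proof -
    have "(\<Sum>\<alpha>\<in>F\<union>G. monomial z \<alpha> *\<^sub>C e \<alpha>) =
        (\<Sum>\<alpha>\<in>F\<union>G. monomial z \<alpha> *\<^sub>C (if \<alpha> \<in> F then c \<alpha> else 0)) + (\<Sum>\<alpha>\<in>F\<union>G. monomial z \<alpha> *\<^sub>C (if \<alpha> \<in> G then d \<alpha> else 0))"
      by (simp add: e_def scaleC_add_right sum.distrib)
    also have "(\<Sum>\<alpha>\<in>F\<union>G. monomial z \<alpha> *\<^sub>C (if \<alpha> \<in> F then c \<alpha> else 0)) = (\<Sum>\<alpha>\<in>F. monomial z \<alpha> *\<^sub>C c \<alpha>)"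
      using F(1) G(1) by (intro sum.mono_neutral_cong_right) (auto simp: scaleC.zero_right)
    also have "(\<Sum>\<alpha>\<in>F\<union>G. monomial z \<alpha> *\<^sub>C (if \<alpha> \<in> G then d \<alpha> else 0)) = (\<Sum>\<alpha>\<in>G. monomial z \<alpha> *\<^sub>C d \<alpha>)"
      using F(1) G(1) by (intro sum.mono_neutral_cong_right) (auto simp: scaleC.zero_right)
    finally show ?thesis
      using F(3) G(3) that by simp
  qed
  then show ?thesis
    unfolding trig_poly_def using F G by (intro exI[of _ "F \<union> G"] exI[of _ e]) auto
qed

lemma trig_poly_sum:
  assumes "\<And>i. i \<in> I \<Longrightarrow> trig_poly (P i)"
  shows "trig_poly (\<lambda>z. \<Sum>i\<in>I. P i z)"
  using assms
  by (induction I rule: infinite_finite_induct) (auto intro: trig_poly_const trig_poly_add)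

text \<open>With scalar \<open>Q\<close> this is the closure under products that Stone--Weierstrass
  asks for; with \<open>Q\<close> a constant vector it builds vector-valued polynomials from scalar
  ones.\<close>

lemma trig_poly_scaleC:
  fixes Q :: "(nat \<Rightarrow> complex) \<Rightarrow> 'a::complex_banach"
  assumes "trig_poly P" "trig_poly Q"
  shows "trig_poly (\<lambda>z. P z *\<^sub>C Q z)"
proof -
  obtain F c where F: "finite F" "F \<subseteq> int_multi_indices" "\<And>z. z \<in> torus \<Longrightarrow> P z = (\<Sum>\<alpha>\<in>F. monomial z \<alpha> *\<^sub>C c \<alpha>)"
    using assms(1) unfolding trig_poly_def by blast
  obtain G d where G: "finite G" "G \<subseteq> int_multi_indices" "\<And>z. z \<in> torus \<Longrightarrow> Q z = (\<Sum>\<alpha>\<in>G. monomial z \<alpha> *\<^sub>C d \<alpha>)"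
    using assms(2) unfolding trig_poly_def by blast
  have "trig_poly (\<lambda>z. \<Sum>\<alpha>\<in>F. \<Sum>\<beta>\<in>G. monomial z (\<lambda>k. \<alpha> k + \<beta> k) *\<^sub>C c \<alpha> *\<^sub>C d \<beta>)"
    using F(2) G(2) by (intro trig_poly_sum trig_poly_monomial int_multi_indices_add) auto
  then show ?thesis
  proof (rule trig_poly_cong)
    fix z assume z: "z \<in> torus"
    have "(\<Sum>\<beta>\<in>G. monomial z (\<lambda>k. \<alpha> k + \<beta> k) *\<^sub>C c \<alpha> *\<^sub>C d \<beta>)
        = (\<Sum>\<beta>\<in>G. (monomial z \<alpha> *\<^sub>C c \<alpha>) *\<^sub>C (monomial z \<beta> *\<^sub>C d \<beta>))" if "\<alpha> \<in> F" for \<alpha>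
      using that F(2) G(2) z
      by (intro sum.cong) (auto simp: monomial_add subset_iff scaleC_scaleC scaleC_complex_def mult_ac)
    then show "(\<Sum>\<alpha>\<in>F. \<Sum>\<beta>\<in>G. monomial z (\<lambda>k. \<alpha> k + \<beta> k) *\<^sub>C c \<alpha> *\<^sub>C d \<beta>) = P z *\<^sub>C Q z"
      by (simp add: F(3)[OF z] scaleC.sum_left, simp add: G(3)[OF z] scaleC.sum_right)
  qed
qed

lemma continuous_on_trig_poly:
  assumes "trig_poly P"
  shows "continuous_on torus P"
proof -
  obtain F c where F: "finite F" "F \<subseteq> int_multi_indices" "\<And>z. z \<in> torus \<Longrightarrow> P z = (\<Sum>\<alpha>\<in>F. monomial z \<alpha> *\<^sub>C c \<alpha>)"
    using assms(1) unfolding trig_poly_def by blast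
  have "continuous_on torus (\<lambda>z. \<Sum>\<alpha>\<in>F. monomial z \<alpha> *\<^sub>C c \<alpha>)"
    by (intro continuous_on_sum scaleC.continuous_on continuous_on_monomial continuous_on_const)
  then show ?thesis
    using F(3) by (metis (mono_tags, lifting) continuous_on_cong)
qed

lemma simple_limit_trig_poly:
  assumes "trig_poly P"
  shows "simple_limit torus_measure P"
proof -
  obtain F c where F: "finite F" "F \<subseteq> int_multi_indices" "\<And>z. z \<in> torus \<Longrightarrow> P z = (\<Sum>\<alpha>\<in>F. monomial z \<alpha> *\<^sub>C c \<alpha>)"
    using assms(1) unfolding trig_poly_def by blast
  have "simple_limit torus_measure (\<lambda>z. \<Sum>\<alpha>\<in>F. monomial z \<alpha> *\<^sub>C c \<alpha>)"
    by (intro simple_limit_sum simple_limit_scaleC simple_limit_const simple_limit_borel_measurable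
        borel_measurable_monomial)
  then show ?thesis
    unfolding simple_limit_def using F(3) by (simp add: space_torus_measure)
qed

lemma trig_poly_approx_continuous:
  fixes f :: "(nat \<Rightarrow> complex) \<Rightarrow> real"
  assumes f: "continuous_on torus f" and e: "e > 0"
  obtains Q where "trig_poly Q" "\<And>z. z \<in> torus \<Longrightarrow> cmod (of_real (f z) - Q z) < e"
proof -
  \<comment> \<open>Stone--Weierstrass is applied in its real form, so the algebra consists of the
    real functions that become trigonometric polynomials when read as complex ones.\<close>
  define R where "R = {f :: (nat \<Rightarrow> complex) \<Rightarrow> real. trig_poly (\<lambda>z. complex_of_real (f z))}"
  interpret function_ring_on R torus
  proof
    show "compact torus" by (rule compact_torus)
    show "continuous_on torus f" if "f \<in> R" for f
      using continuous_on_Re[OF continuous_on_trig_poly[of "\<lambda>z. complex_of_real (f z)"]] that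
      by (simp add: R_def)
    show "(\<lambda>x. f x + g x) \<in> R" if "f \<in> R" "g \<in> R" for f g
      using that trig_poly_add by (force simp: R_def)
    show "(\<lambda>x. f x * g x) \<in> R" if "f \<in> R" "g \<in> R" for f g
      using that trig_poly_scaleC[of "\<lambda>z. complex_of_real (f z)" "\<lambda>z. complex_of_real (g z)"]
      by (simp add: R_def scaleC_complex_def)
    show "(\<lambda>_. c) \<in> R" for c
      by (simp add: R_def trig_poly_const)
    show "\<exists>f\<in>R. f x \<noteq> f y" if xy: "x \<in> torus" "y \<in> torus" "x \<noteq> y" for x y
    proof -
      obtain k where k: "x k \<noteq> y k"
        using xy(3) by blast
      let ?m = "\<lambda>z n. monomial z (\<lambda>j. if j = k then n else 0)"
      have lin: "trig_poly (\<lambda>z. ?m z 1 *\<^sub>C a + ?m z (- 1) *\<^sub>C b)" for a b :: complex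
        by (intro trig_poly_add trig_poly_monomial int_multi_indices_single)
      have inv: "inverse (z k) = cnj (z k)" if "z \<in> torus" for z
        using that torus_nonzero[OF that, of k] complex_norm_square[of "z k"]
        by (simp add: torus_def field_simps)
      \<comment> \<open>Separation of points: on the torus the real part of w is (w + w^-1)/2 and
        the imaginary part is (-i w + i w^-1)/2.\<close>
      have "(\<lambda>z. Re (z k)) \<in> R"
        unfolding R_def mem_Collect_eq using lin[of "1/2" "1/2"]
        by (rule trig_poly_cong)
           (simp add: monomial_single power_int_minus inv scaleC_complex_def complex_eq_iff)
      moreover have "(\<lambda>z. Im (z k)) \<in> R"
        unfolding R_def mem_Collect_eq using lin[of "- \<i> / 2" "\<i> / 2"]
        by (rule trig_poly_cong)
           (simp add: monomial_single power_int_minus inv scaleC_complex_def complex_eq_iff)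
      ultimately show ?thesis
        using k by (metis complex_eq_iff)
    qed
  qed
  obtain g where g: "g \<in> R" "\<And>z. z \<in> torus \<Longrightarrow> \<bar>f z - g z\<bar> < e"
    using Stone_Weierstrass_basic[OF f e] by blast
  show thesis
  proof (rule that[of "\<lambda>z. of_real (g z)"])
    show "trig_poly (\<lambda>z. complex_of_real (g z))"
      using g(1) by (simp add: R_def)
    show "cmod (of_real (f z) - of_real (g z)) < e" if "z \<in> torus" for z
      using g(2)[OF that] by (simp flip: of_real_diff)
  qed
qed

section \<open>Density of trigonometric polynomials\<close>

interpretation torus: prob_space torus_measure
  by (rule prob_space_torus_measure)

lemma borel_measurable_norm_powr_simple_limit:
  "simple_limit M f \<Longrightarrow> (\<lambda>x. norm (f x) powr p) \<in> borel_measurable M"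
  using borel_measurable_norm_simple_limit[of M f] by measurable

text \<open>Inner regularity gives a compact subset of nearly full measure, whose indicator is a
  limit of continuous functions, and these are uniform limits of polynomials. The uniform bound 2 is
  recorded because it turns L_1 closeness into L_p closeness and tames products with unbounded
  functions.\<close>

lemma trig_poly_approx_indicator:
  fixes e :: real
  assumes A: "A \<in> sets torus_measure" and e: "e > 0"
  obtains Q :: "(nat \<Rightarrow> complex) \<Rightarrow> complex"
  where "trig_poly Q" "\<And>z. z \<in> torus \<Longrightarrow> cmod (indicator A z - Q z) \<le> 2"
    "(\<integral>\<^sup>+ z. ennreal (cmod (indicator A z - Q z)) \<partial>torus_measure) \<le> ennreal e"
proof -
  let ?N = "distr torus_measure borel (\<lambda>z. z)"
  have id: "(\<lambda>z. z) \<in> borel_measurable torus_measure"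
    by (intro borel_measurable_continuous_on_torus continuous_on_id)
  \<comment> \<open>Regularity is available for Borel measures on all of \<open>nat \<Rightarrow> complex\<close>, so \<open>A\<close> is written as
    the trace of a Borel set, using a Borel retraction onto the torus.\<close>
  obtain B where B: "B \<in> sets borel" "A = B \<inter> torus"
  proof -
    define r where "r z = (\<lambda>k::nat. if cmod (z k) = 1 then z k else 1)" for z :: "nat \<Rightarrow> complex"
    have "r \<in> borel \<rightarrow>\<^sub>M torus_measure"
      unfolding torus_measure_def
    proof (rule measurable_PiM_single')
      fix k :: nat
      have comp: "(\<lambda>z. z k) \<in> borel_measurable (borel :: (nat \<Rightarrow> complex) measure)"
        by (intro borel_measurable_continuous_onI continuous_on_product_coordinates)
      have "(\<lambda>z. r z k) \<in> borel \<rightarrow>\<^sub>M restrict_space borel (sphere 0 1)"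
      proof (rule measurable_restrict_space2)
        show "(\<lambda>z. r z k) \<in> borel_measurable borel"
          unfolding r_def using comp by measurable
      qed (auto simp: r_def)
      then show "(\<lambda>z. r z k) \<in> borel \<rightarrow>\<^sub>M circle_measure"
        by (simp add: circle_measure_def measurable_distr_eq1 cong: measurable_cong_sets)
    qed (auto simp: r_def space_circle_measure)
    then have "r -` A \<in> sets borel"
      using measurable_sets[OF _ A, of r borel] by simp
    moreover have "A = r -` A \<inter> torus"
    proof -
      have "r z = z" if "z \<in> torus" for z
        using that by (auto simp: r_def torus_def)
      then show ?thesis
        using sets.sets_into_space[OF A] by (auto simp: space_torus_measure)
    qed
    ultimately show thesis by (rule that)
  qed
  have fin: "emeasure ?N (space ?N) \<noteq> \<infinity>"
    using torus.prob_space_distr[OF id] prob_space.emeasure_space_1 by fastforce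
  \<comment> \<open>One third of \<open>e\<close> for each passage: from \<open>B\<close> to
    \<open>K\<close>, from \<open>K\<close> to a continuous function, from there to a
    polynomial.\<close>
  obtain K where K: "K \<subseteq> B" "compact K" "emeasure ?N B < emeasure ?N K + ennreal (e / 3)"
  proof -
    have "emeasure ?N B \<le> emeasure ?N (space ?N)"
      by (intro emeasure_mono) auto
    then have "emeasure ?N B \<noteq> \<infinity>"
      using fin by (auto simp: top_unique)
    then have "\<exists>K\<in>{K. K \<subseteq> B \<and> compact K}. emeasure ?N B < emeasure ?N K + ennreal (e / 3)"
      using e inner_regular[OF _ fin B(1)]
      by (intro SUP_approx_ennreal) auto
    then show thesis using that by blast
  qed
  have Kb: "K \<in> sets borel" using K(2) by (simp add: compact_imp_closed borel_closed)
  \<comment> \<open>A ramp equal to 1 on \<open>K\<close> and to 0 at distance at least 1/n from it,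
    for positive n. The empty set is treated apart because \<open>infdist z {}\<close> is 0, which
    would give the value 1 everywhere.\<close>
  define u :: "nat \<Rightarrow> (nat \<Rightarrow> complex) \<Rightarrow> real"
    where "u n z = (if K = {} then 0 else max 0 (1 - real n * infdist z K))" for n z
  have u01: "0 \<le> u n z" "u n z \<le> 1" for n z
    by (auto simp: u_def infdist_nonneg)
  have u_cont: "continuous_on torus (u n)" for n
    unfolding u_def by (cases "K = {}") (auto intro!: continuous_intros)
  have [measurable]: "u n \<in> borel_measurable torus_measure" for n
    by (intro borel_measurable_continuous_on_torus u_cont)
  have sets_torus [measurable]: "K \<inter> torus \<in> sets torus_measure" "B \<inter> torus \<in> sets torus_measure"
    using measurable_sets[OF id Kb] measurable_sets[OF id B(1)] by (simp_all add: space_torus_measure Int_def conj_commute)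
  have u_lim: "(\<lambda>n. u n z) \<longlonglongrightarrow> indicator K z" for z
  proof (cases "z \<in> K \<or> K = {}")
    case True
    then have "u n z = indicator K z" for n
      by (auto simp: u_def)
    then show ?thesis by simp
  next
    case False
    then have pos: "infdist z K > 0"
      using K(2) compact_imp_closed infdist_pos_not_in_closed by blast
    obtain m where m: "1 < real m * infdist z K"
      using reals_Archimedean3[OF pos] by blast
    have "u n z = 0" if "n \<ge> m" for n
    proof -
      have "real m * infdist z K \<le> real n * infdist z K"
        using that pos by (intro mult_right_mono) auto
      then show ?thesis
        using m by (simp add: u_def)
    qed
    then have "\<forall>\<^sub>F n in sequentially. u n z = indicator K z"
      using False by (auto simp: eventually_sequentially)
    then show ?thesis
      by (rule tendsto_eventually)
  qed
  have "(\<lambda>n. \<integral>\<^sup>+ z. ennreal \<bar>indicator (K \<inter> torus) z - u n z\<bar> \<partial>torus_measure) \<longlonglongrightarrow> (\<integral>\<^sup>+ z. 0 \<partial>torus_measure)"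
  proof (rule nn_integral_dominated_convergence)
    show "AE z in torus_measure. ennreal \<bar>indicator (K \<inter> torus) z - u n z\<bar> \<le> 1" for n
    proof (rule AE_I2)
      fix z
      have "\<bar>indicator (K \<inter> torus) z - u n z\<bar> \<le> 1"
        using u01[of n z] by (auto simp: indicator_def)
      then show "ennreal \<bar>indicator (K \<inter> torus) z - u n z\<bar> \<le> 1"
        using ennreal_leI by fastforce
    qed
    show "(\<integral>\<^sup>+ z. 1 \<partial>torus_measure) < \<infinity>"
      by (simp add: torus.emeasure_space_1)
    show "AE z in torus_measure. (\<lambda>n. ennreal \<bar>indicator (K \<inter> torus) z - u n z\<bar>) \<longlonglongrightarrow> 0"
    proof (rule AE_I2)
      fix z assume "z \<in> space torus_measure"
      then have "indicator (K \<inter> torus) z = (indicator K z :: real)"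
        by (simp add: space_torus_measure indicator_def)
      moreover have "(\<lambda>n. \<bar>indicator K z - u n z\<bar>) \<longlonglongrightarrow> \<bar>indicator K z - indicator K z\<bar>"
        by (intro tendsto_intros u_lim)
      ultimately show "(\<lambda>n. ennreal \<bar>indicator (K \<inter> torus) z - u n z\<bar>) \<longlonglongrightarrow> 0"
        by (simp add: tendsto_ennrealI flip: ennreal_0)
    qed
  qed auto
  then have "\<forall>\<^sub>F n in sequentially. (\<integral>\<^sup>+ z. ennreal \<bar>indicator (K \<inter> torus) z - u n z\<bar> \<partial>torus_measure) < ennreal (e / 3)"
    using e by (intro order_tendstoD(2)) auto
  then obtain n where n: "(\<integral>\<^sup>+ z. ennreal \<bar>indicator (K \<inter> torus) z - u n z\<bar> \<partial>torus_measure) < ennreal (e / 3)"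
    by (auto simp: eventually_sequentially)
  \<comment> \<open>The tolerance 1, together with the distance at most 1 between \<open>u n\<close>
    and the indicator, gives the uniform bound 2; the tolerance \<open>e / 3\<close> gives the
    integral bound.\<close>
  obtain Q where Q: "trig_poly Q" "\<And>z. z \<in> torus \<Longrightarrow> cmod (of_real (u n z) - Q z) < min 1 (e / 3)"
    using trig_poly_approx_continuous[OF u_cont, of "min 1 (e / 3)" n] e by auto
  show thesis
  proof (rule that[OF Q(1)])
    fix z assume z: "z \<in> torus"
    have "cmod (indicator A z - Q z) \<le> cmod (indicator A z - of_real (u n z)) + cmod (of_real (u n z) - Q z)"
      by norm
    also have "cmod (indicator A z - of_real (u n z)) = \<bar>indicator A z - u n z\<bar>"
      by (metis norm_of_real of_real_diff of_real_indicator real_norm_def)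
    also have "\<dots> \<le> 1"
      using u01[of n z] by (auto simp: indicator_def)
    finally show "cmod (indicator A z - Q z) \<le> 2"
      using Q(2)[OF z] by simp
  next
    have "(\<integral>\<^sup>+ z. ennreal (cmod (indicator A z - Q z)) \<partial>torus_measure)
        \<le> (\<integral>\<^sup>+ z. indicator (B \<inter> torus - K \<inter> torus) z + ennreal \<bar>indicator (K \<inter> torus) z - u n z\<bar> + ennreal (e / 3) \<partial>torus_measure)"
    proof (intro nn_integral_mono)
      fix z assume "z \<in> space torus_measure"
      then have z: "z \<in> torus" by (simp add: space_torus_measure)
      have "cmod (indicator A z - Q z) \<le> cmod (indicator A z - of_real (u n z)) + cmod (of_real (u n z) - Q z)"
        by norm
      also have "cmod (indicator A z - of_real (u n z)) = \<bar>indicator A z - u n z\<bar>"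
        by (metis norm_of_real of_real_diff of_real_indicator real_norm_def)
      also have "\<dots> \<le> indicator (B \<inter> torus - K \<inter> torus) z + \<bar>indicator (K \<inter> torus) z - u n z\<bar>"
        using u01[of n z] K(1) B(2) z by (auto simp: indicator_def)
      finally have "cmod (indicator A z - Q z) \<le> indicator (B \<inter> torus - K \<inter> torus) z + \<bar>indicator (K \<inter> torus) z - u n z\<bar> + e / 3"
        using Q(2)[OF z] by simp
      then have "ennreal (cmod (indicator A z - Q z)) \<le>
          ennreal (indicator (B \<inter> torus - K \<inter> torus) z + \<bar>indicator (K \<inter> torus) z - u n z\<bar> + e / 3)"
        by (rule ennreal_leI)
      also have "\<dots> = indicator (B \<inter> torus - K \<inter> torus) z + ennreal \<bar>indicator (K \<inter> torus) z - u n z\<bar> + ennreal (e / 3)"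
        using e by (simp add: ennreal_indicator)
      finally show "ennreal (cmod (indicator A z - Q z)) \<le> \<dots>" .
    qed
    also have "\<dots> = emeasure torus_measure (B \<inter> torus - K \<inter> torus)
        + (\<integral>\<^sup>+ z. ennreal \<bar>indicator (K \<inter> torus) z - u n z\<bar> \<partial>torus_measure) + ennreal (e / 3)"
      by (simp add: nn_integral_add torus.emeasure_space_1)
    also have "\<dots> \<le> ennreal (e / 3) + ennreal (e / 3) + ennreal (e / 3)"
    proof (intro add_mono order.refl)
      have N: "emeasure ?N B = emeasure torus_measure (B \<inter> torus)" "emeasure ?N K = emeasure torus_measure (K \<inter> torus)"
        using B(1) Kb by (simp_all add: emeasure_distr[OF id] space_torus_measure)
      have "emeasure torus_measure (B \<inter> torus - K \<inter> torus) = emeasure torus_measure (B \<inter> torus) - emeasure torus_measure (K \<inter> torus)"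
        using K(1) by (intro emeasure_Diff) auto
      also have "\<dots> \<le> ennreal (e / 3)"
        using K(3) unfolding N by (intro ennreal_minus_le_iff[THEN iffD2]) auto
      finally show "emeasure torus_measure (B \<inter> torus - K \<inter> torus) \<le> ennreal (e / 3)" .
      show "(\<integral>\<^sup>+ z. ennreal \<bar>indicator (K \<inter> torus) z - u n z\<bar> \<partial>torus_measure) \<le> ennreal (e / 3)"
        using n by simp
    qed
    also have "\<dots> = ennreal e"
      using e by (simp flip: ennreal_plus)
    finally show "(\<integral>\<^sup>+ z. ennreal (cmod (indicator A z - Q z)) \<partial>torus_measure) \<le> ennreal e" .
  qed
qed

lemma simple_function_sum_indicator:
  fixes s :: "'s \<Rightarrow> 'a::real_vector"
  assumes "simple_function M s" "z \<in> space M"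
  shows "s z = (\<Sum>x\<in>s ` space M. indicator (s -` {x} \<inter> space M) z *\<^sub>R x)"
proof -
  have "(\<Sum>x\<in>s ` space M. indicator (s -` {x} \<inter> space M) z *\<^sub>R x) = (\<Sum>x\<in>s ` space M. if x = s z then x else 0)"
    using assms(2) by (intro sum.cong) (auto simp: indicator_def)
  also have "\<dots> = s z"
    using assms by (simp add: simple_function_def)
  finally show ?thesis ..
qed

text \<open>Each level set's indicator is replaced by a polynomial. The error u is bounded by
  \<open>B\<close>, so u^p <= \<open>B powr (p - 1)\<close> * u, and the L_1 estimates for the
  indicators suffice.\<close>

lemma trig_poly_approx_simple_function:
  fixes s :: "(nat \<Rightarrow> complex) \<Rightarrow> 'a::complex_banach" and p e :: real
  assumes s: "simple_function torus_measure s" and p: "p \<ge> 1" and e: "e > 0"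
  obtains P where "trig_poly P" "(\<integral>\<^sup>+ z. ennreal (norm (s z - P z) powr p) \<partial>torus_measure) \<le> ennreal e"
proof -
  let ?Y = "s ` space torus_measure" and ?A = "\<lambda>x. s -` {x} \<inter> space torus_measure"
  \<comment> \<open>Each indicator is missed by at most 2, so \<open>B\<close> bounds the whole
    error; the summand 1 keeps \<open>B\<close> positive even if \<open>s\<close> vanishes.\<close>
  define B where "B = 1 + (\<Sum>x\<in>?Y. 2 * norm x)"
  have B: "B \<ge> 1" by (simp add: B_def sum_nonneg)
  \<comment> \<open>Solves \<open>B powr (p - 1) * (B * d) = e\<close>.\<close>
  define d where "d = e / (B powr (p - 1) * B)"
  have d: "d > 0" using B e by (simp add: d_def)
  have A: "?A x \<in> sets torus_measure" for x
    using s by (rule simple_functionD)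
  have "\<forall>x. \<exists>Q. trig_poly Q \<and> (\<forall>z\<in>torus. cmod (indicator (?A x) z - Q z) \<le> 2) \<and>
      (\<integral>\<^sup>+ z. ennreal (cmod (indicator (?A x) z - Q z)) \<partial>torus_measure) \<le> ennreal d"
    by (rule allI, rule trig_poly_approx_indicator[OF A d]) blast
  from choice[OF this] obtain Q where Q: "\<And>x. trig_poly (Q x)" "\<And>x z. z \<in> torus \<Longrightarrow> cmod (indicator (?A x) z - Q x z) \<le> 2"
    "\<And>x. (\<integral>\<^sup>+ z. ennreal (cmod (indicator (?A x) z - Q x z)) \<partial>torus_measure) \<le> ennreal d"
    by blast
  define P where "P z = (\<Sum>x\<in>?Y. Q x z *\<^sub>C x)" for z
  have [measurable]: "(\<lambda>z. cmod (indicator (?A x) z - Q x z)) \<in> borel_measurable torus_measure" for x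
    using A[of x] borel_measurable_simple_limit[OF simple_limit_trig_poly[OF Q(1)[of x]]] by measurable
  have le: "norm (s z - P z) \<le> (\<Sum>x\<in>?Y. norm x * cmod (indicator (?A x) z - Q x z))" if z: "z \<in> torus" for z
  proof -
    have "s z - P z = (\<Sum>x\<in>?Y. (indicator (?A x) z - Q x z) *\<^sub>C x)"
    proof -
      have "s z = (\<Sum>x\<in>?Y. indicator (?A x) z *\<^sub>R x)"
        using z by (intro simple_function_sum_indicator[OF s]) (simp add: space_torus_measure)
      also have "\<dots> = (\<Sum>x\<in>?Y. indicator (?A x) z *\<^sub>C x)"
        by (intro sum.cong refl) (simp only: scaleR_scaleC of_real_indicator)
      finally have "s z = (\<Sum>x\<in>?Y. indicator (?A x) z *\<^sub>C x)" .
      moreover have "(\<Sum>x\<in>?Y. (indicator (?A x) z - Q x z) *\<^sub>C x) = (\<Sum>x\<in>?Y. indicator (?A x) z *\<^sub>C x) - P z"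
        by (simp only: P_def scaleC.diff_left sum_subtractf)
      ultimately show ?thesis
        by (rule trans[OF arg_cong sym])
    qed
    also have "norm \<dots> \<le> (\<Sum>x\<in>?Y. norm ((indicator (?A x) z - Q x z) *\<^sub>C x))"
      by (rule norm_sum)
    also have "\<dots> = (\<Sum>x\<in>?Y. norm x * cmod (indicator (?A x) z - Q x z))"
      by (simp add: norm_scaleC mult.commute)
    finally show ?thesis .
  qed
  have leB: "norm (s z - P z) \<le> B" if z: "z \<in> torus" for z
  proof -
    have "(\<Sum>x\<in>?Y. norm x * cmod (indicator (?A x) z - Q x z)) \<le> (\<Sum>x\<in>?Y. norm x * 2)"
      using Q(2)[OF z] by (intro sum_mono mult_left_mono) auto
    with le[OF z] show ?thesis
      by (simp add: B_def mult.commute)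
  qed
  have "(\<integral>\<^sup>+ z. ennreal (norm (s z - P z) powr p) \<partial>torus_measure)
      \<le> (\<integral>\<^sup>+ z. ennreal (B powr (p - 1)) * (\<Sum>x\<in>?Y. ennreal (norm x) * ennreal (cmod (indicator (?A x) z - Q x z))) \<partial>torus_measure)"
  proof (intro nn_integral_mono)
    fix z assume "z \<in> space torus_measure"
    then have z: "z \<in> torus" by (simp add: space_torus_measure)
    have "norm (s z - P z) powr p = norm (s z - P z) powr (p - 1) * norm (s z - P z)"
      using powr_mult_base[of "norm (s z - P z)" "p - 1"] by (simp add: mult.commute)
    also have "\<dots> \<le> B powr (p - 1) * (\<Sum>x\<in>?Y. norm x * cmod (indicator (?A x) z - Q x z))"
      using p le[OF z] leB[OF z] by (intro mult_mono powr_mono2) auto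
    finally have "ennreal (norm (s z - P z) powr p)
        \<le> ennreal (B powr (p - 1) * (\<Sum>x\<in>?Y. norm x * cmod (indicator (?A x) z - Q x z)))"
      by (rule ennreal_leI)
    also have "\<dots> = ennreal (B powr (p - 1)) * (\<Sum>x\<in>?Y. ennreal (norm x) * ennreal (cmod (indicator (?A x) z - Q x z)))"
      by (simp add: ennreal_mult sum_nonneg flip: sum_ennreal)
    finally show "ennreal (norm (s z - P z) powr p) \<le> \<dots>" .
  qed
  also have "\<dots> = ennreal (B powr (p - 1)) * (\<Sum>x\<in>?Y. ennreal (norm x) * (\<integral>\<^sup>+ z. ennreal (cmod (indicator (?A x) z - Q x z)) \<partial>torus_measure))"
    by (simp add: nn_integral_cmult nn_integral_sum)
  also have "\<dots> \<le> ennreal (B powr (p - 1)) * (\<Sum>x\<in>?Y. ennreal (norm x) * ennreal d)"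
    by (intro mult_left_mono sum_mono Q) auto
  also have "\<dots> = ennreal (B powr (p - 1) * ((\<Sum>x\<in>?Y. norm x) * d))"
    using d by (simp add: ennreal_mult sum_nonneg sum_distrib_right flip: sum_ennreal)
  also have "\<dots> \<le> ennreal (B powr (p - 1) * (B * d))"
  proof -
    have "(\<Sum>x\<in>?Y. norm x) \<le> B"
      unfolding B_def by (simp add: sum_nonneg flip: sum_distrib_left)
    then show ?thesis
      using d by (intro ennreal_leI mult_left_mono mult_right_mono) auto
  qed
  also have "\<dots> = ennreal e"
    using B by (simp add: d_def)
  finally have "(\<integral>\<^sup>+ z. ennreal (norm (s z - P z) powr p) \<partial>torus_measure) \<le> ennreal e" .
  moreover have "trig_poly P"
    unfolding P_def by (intro trig_poly_sum trig_poly_scaleC trig_poly_const Q)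
  ultimately show thesis by (rule that[rotated])
qed

text \<open>The crude factor is harmless where two small errors are added. Where the norm of the
  function itself must be kept, \<open>powr_add_le_convex\<close> is used.\<close>

lemma norm_add_powr_le:
  fixes x y :: "'a::real_normed_vector" and p :: real
  assumes "p \<ge> 0"
  shows "norm (x + y) powr p \<le> 2 powr p * (norm x powr p + norm y powr p)"
proof -
  have "norm (x + y) powr p \<le> (2 * max (norm x) (norm y)) powr p"
    using assms norm_triangle_ineq[of x y] by (intro powr_mono2) auto
  also have "\<dots> = 2 powr p * max (norm x) (norm y) powr p"
    by (simp add: powr_mult)
  also have "\<dots> \<le> 2 powr p * (norm x powr p + norm y powr p)"
    by (intro mult_left_mono) (auto simp: max_def)
  finally show ?thesis .
qed

lemma trig_poly_dense:
  fixes f :: "(nat \<Rightarrow> complex) \<Rightarrow> 'a::complex_banach" and p e :: real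
  assumes f: "simple_limit torus_measure f" "(\<integral>\<^sup>+ z. ennreal (norm (f z) powr p) \<partial>torus_measure) < \<infinity>"
    and p: "p \<ge> 1" and e: "e > 0"
  obtains P where "trig_poly P" "(\<integral>\<^sup>+ z. ennreal (norm (f z - P z) powr p) \<partial>torus_measure) \<le> ennreal e"
proof -
  \<comment> \<open>Halved for the two errors, then divided by the factor of
    \<open>norm_add_powr_le\<close>.\<close>
  define d where "d = e / 2 / 2 powr p"
  have d: "d > 0" using e by (simp add: d_def)
  obtain s where s: "simple_function torus_measure s" "(\<integral>\<^sup>+ z. ennreal (norm (f z - s z) powr p) \<partial>torus_measure) < ennreal d"
    using simple_function_Lp_approx[OF f _ d] p by auto
  obtain P where P: "trig_poly P" "(\<integral>\<^sup>+ z. ennreal (norm (s z - P z) powr p) \<partial>torus_measure) \<le> ennreal d"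
    using trig_poly_approx_simple_function[OF s(1) p d] by metis
  have [measurable]: "(\<lambda>z. norm (f z - s z) powr p) \<in> borel_measurable torus_measure"
    "(\<lambda>z. norm (s z - P z) powr p) \<in> borel_measurable torus_measure"
    by (intro borel_measurable_norm_powr_simple_limit simple_limit_diff f simple_limit_simple_function s
        simple_limit_trig_poly P)+
  have "(\<integral>\<^sup>+ z. ennreal (norm (f z - P z) powr p) \<partial>torus_measure)
     \<le> (\<integral>\<^sup>+ z. ennreal (2 powr p) * (ennreal (norm (f z - s z) powr p) + ennreal (norm (s z - P z) powr p)) \<partial>torus_measure)"
    using norm_add_powr_le[of p "f z - s z" "s z - P z" for z] p
    by (intro nn_integral_mono) (simp add: ennreal_leI flip: ennreal_mult ennreal_plus)
  also have "\<dots> = ennreal (2 powr p) * ((\<integral>\<^sup>+ z. ennreal (norm (f z - s z) powr p) \<partial>torus_measure)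
      + (\<integral>\<^sup>+ z. ennreal (norm (s z - P z) powr p) \<partial>torus_measure))"
    by (simp add: nn_integral_cmult nn_integral_add)
  also have "\<dots> \<le> ennreal (2 powr p) * (ennreal d + ennreal d)"
    using s(2) P(2) by (intro mult_left_mono add_mono) auto
  also have "\<dots> = ennreal e"
    using d by (simp add: d_def flip: ennreal_mult ennreal_plus)
  finally show thesis
    by (rule that[OF P(1)])
qed

section \<open>Fourier coefficients\<close>

lemma bochner_integrable_scaleC_bounded:
  fixes f :: "'s \<Rightarrow> 'a::complex_normed_vector"
  assumes c: "c \<in> borel_measurable M" "\<And>z. z \<in> space M \<Longrightarrow> cmod (c z) \<le> B"
    and f: "bochner_integrable M f"
  shows "bochner_integrable M (\<lambda>z. c z *\<^sub>C f z)"
  unfolding bochner_integrable_def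
proof
  show "strongly_measurable M (\<lambda>z. c z *\<^sub>C f z)"
    using f c(1) by (intro strongly_measurable_scaleC) (auto simp: bochner_integrable_def)
  obtain g where g: "simple_limit M g" "AE x in M. f x = g x" "(\<integral>\<^sup>+ x. ennreal (norm (g x)) \<partial>M) < \<infinity>"
    using f by (rule bochner_integrableE)
  note [measurable] = borel_measurable_norm_simple_limit[OF g(1)]
  have "(\<integral>\<^sup>+ z. ennreal (norm (c z *\<^sub>C f z)) \<partial>M) \<le> (\<integral>\<^sup>+ z. ennreal (max 0 B) * ennreal (norm (g z)) \<partial>M)"
  proof (intro nn_integral_mono_AE)
    show "AE z in M. ennreal (norm (c z *\<^sub>C f z)) \<le> ennreal (max 0 B) * ennreal (norm (g z))"
      using g(2) AE_space
    proof eventually_elim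
      case (elim z)
      have "norm (c z *\<^sub>C f z) \<le> max 0 B * norm (g z)"
        unfolding norm_scaleC elim(1) using c(2)[OF elim(2)] by (intro mult_right_mono) auto
      then have "ennreal (norm (c z *\<^sub>C f z)) \<le> ennreal (max 0 B * norm (g z))"
        by (rule ennreal_leI)
      also have "\<dots> = ennreal (max 0 B) * ennreal (norm (g z))"
        by (rule ennreal_mult) auto
      finally show ?case .
    qed
  qed
  also have "\<dots> = ennreal (max 0 B) * (\<integral>\<^sup>+ z. ennreal (norm (g z)) \<partial>M)"
    by (simp add: nn_integral_cmult)
  also have "\<dots> < \<infinity>"
    using g(3) by (simp add: ennreal_mult_less_top)
  finally show "(\<integral>\<^sup>+ z. ennreal (norm (c z *\<^sub>C f z)) \<partial>M) < \<infinity>" .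
qed

lemma bochner_integrable_monomial:
  fixes f :: "(nat \<Rightarrow> complex) \<Rightarrow> 'a::complex_normed_vector"
  shows "bochner_integrable torus_measure f \<Longrightarrow> bochner_integrable torus_measure (\<lambda>z. monomial z \<alpha> *\<^sub>C f z)"
  by (rule bochner_integrable_scaleC_bounded[where B = 1])
     (auto simp: borel_measurable_monomial space_torus_measure norm_monomial)

lemma has_bochner_int_fourier_coeff:
  assumes "bochner_integrable torus_measure f"
  shows "has_bochner_int torus_measure (\<lambda>z. monomial z (\<lambda>k. - \<alpha> k) *\<^sub>C f z) (fourier_coeff f \<alpha>)"
  unfolding fourier_coeff_def
  by (intro torus.has_bochner_int_bochner_int bochner_integrable_monomial assms)

lemma fourier_coeff_cong_AE:
  assumes "AE z in torus_measure. f z = g z"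
  shows "fourier_coeff f \<alpha> = fourier_coeff g \<alpha>"
  unfolding fourier_coeff_def using assms by (intro bochner_int_cong_AE) (auto elim: eventually_mono)

text \<open>Monomials have modulus 1 on the torus, so every coefficient is a contraction from L_1,
  uniformly in \<open>\<alpha>\<close>.\<close>

lemma norm_fourier_coeff_diff_le:
  assumes "bochner_integrable torus_measure f" "bochner_integrable torus_measure g"
  shows "ennreal (norm (fourier_coeff f \<alpha> - fourier_coeff g \<alpha>)) \<le> (\<integral>\<^sup>+ z. ennreal (norm (f z - g z)) \<partial>torus_measure)"
proof -
  have "ennreal (norm (fourier_coeff f \<alpha> - fourier_coeff g \<alpha>))
     \<le> (\<integral>\<^sup>+ z. ennreal (norm (monomial z (\<lambda>k. - \<alpha> k) *\<^sub>C f z - monomial z (\<lambda>k. - \<alpha> k) *\<^sub>C g z)) \<partial>torus_measure)"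
    by (intro torus.has_bochner_int_norm_diff_le has_bochner_int_fourier_coeff assms)
  also have "\<dots> = (\<integral>\<^sup>+ z. ennreal (norm (f z - g z)) \<partial>torus_measure)"
    by (intro nn_integral_cong)
       (simp add: space_torus_measure norm_monomial norm_scaleC flip: scaleC.diff_right)
  finally show ?thesis .
qed

lemma fourier_coeff_diff:
  assumes "bochner_integrable torus_measure f" "bochner_integrable torus_measure g"
  shows "fourier_coeff (\<lambda>z. f z - g z) \<alpha> = fourier_coeff f \<alpha> - fourier_coeff g \<alpha>"
proof -
  have "has_bochner_int torus_measure (\<lambda>z. monomial z (\<lambda>k. - \<alpha> k) *\<^sub>C f z + - (monomial z (\<lambda>k. - \<alpha> k) *\<^sub>C g z))
      (fourier_coeff f \<alpha> + - fourier_coeff g \<alpha>)"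
    by (intro has_bochner_int_add has_bochner_int_fourier_coeff assms
        has_bochner_int_bounded_linear[OF bounded_linear_minus[OF bounded_linear_ident]])
  then show ?thesis
    unfolding fourier_coeff_def[of "\<lambda>z. f z - g z"]
    by (intro torus.bochner_int_eqI) (simp add: scaleC.diff_right)
qed

lemma bochner_integrable_diff:
  assumes "bochner_integrable M f" "bochner_integrable M g"
  shows "bochner_integrable M (\<lambda>z. f z - g z)"
  unfolding bochner_integrable_def
proof
  show "strongly_measurable M (\<lambda>z. f z - g z)"
    using assms unfolding bochner_integrable_def
    by (intro strongly_measurable_compose2[where h = "(-)"]) (auto intro: tendsto_diff)
  obtain f' where f': "simple_limit M f'" "AE x in M. f x = f' x" "(\<integral>\<^sup>+ x. ennreal (norm (f' x)) \<partial>M) < \<infinity>"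
    using assms(1) by (rule bochner_integrableE)
  obtain g' where g': "simple_limit M g'" "AE x in M. g x = g' x" "(\<integral>\<^sup>+ x. ennreal (norm (g' x)) \<partial>M) < \<infinity>"
    using assms(2) by (rule bochner_integrableE)
  note [measurable] = borel_measurable_norm_simple_limit[OF f'(1)] borel_measurable_norm_simple_limit[OF g'(1)]
  have "(\<integral>\<^sup>+ z. ennreal (norm (f z - g z)) \<partial>M) \<le> (\<integral>\<^sup>+ z. ennreal (norm (f' z)) + ennreal (norm (g' z)) \<partial>M)"
  proof (intro nn_integral_mono_AE)
    show "AE z in M. ennreal (norm (f z - g z)) \<le> ennreal (norm (f' z)) + ennreal (norm (g' z))"
      using f'(2) g'(2)
      by eventually_elim (simp add: ennreal_leI norm_triangle_ineq4 flip: ennreal_plus)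
  qed
  also have "\<dots> < \<infinity>"
    using f'(3) g'(3) by (simp add: nn_integral_add)
  finally show "(\<integral>\<^sup>+ z. ennreal (norm (f z - g z)) \<partial>M) < \<infinity>" .
qed

lemma bochner_integrable_trig_poly:
  assumes "trig_poly P"
  shows "bochner_integrable torus_measure P"
  unfolding bochner_integrable_def
proof
  show "strongly_measurable torus_measure P"
    by (intro strongly_measurable_simple_limit simple_limit_trig_poly assms)
  have "compact (P ` torus)"
    by (intro compact_continuous_image continuous_on_trig_poly assms compact_torus)
  then obtain B where B: "\<And>z. z \<in> torus \<Longrightarrow> norm (P z) \<le> B"
    using compact_imp_bounded bounded_iff by (metis image_eqI)
  have "(\<integral>\<^sup>+ z. ennreal (norm (P z)) \<partial>torus_measure) \<le> (\<integral>\<^sup>+ z. ennreal B \<partial>torus_measure)"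
    by (intro nn_integral_mono ennreal_leI B) (simp add: space_torus_measure)
  also have "\<dots> < \<infinity>"
    by (simp add: torus.emeasure_space_1)
  finally show "(\<integral>\<^sup>+ z. ennreal (norm (P z)) \<partial>torus_measure) < \<infinity>" .
qed

lemma has_bochner_int_monomial:
  fixes x :: "'a::complex_banach"
  assumes "\<alpha> \<in> int_multi_indices"
  shows "has_bochner_int torus_measure (\<lambda>z. monomial z \<alpha> *\<^sub>C x) (if \<alpha> = (\<lambda>k. 0) then x else 0)"
proof -
  have "integrable torus_measure (\<lambda>z. monomial z \<alpha>)"
    by (rule torus.integrable_const_bound[of _ 1])
       (auto simp: borel_measurable_monomial space_torus_measure norm_monomial intro!: AE_I2)
  then have "has_bochner_int torus_measure (\<lambda>z. monomial z \<alpha>) (if \<alpha> = (\<lambda>k. 0) then 1 else 0)"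
    using integral_monomial[OF assms]
    by (intro has_bochner_int_has_bochner_integral) (simp add: has_bochner_integral_iff)
  from has_bochner_int_bounded_linear[OF scaleC.bounded_linear_left this, of x]
  show ?thesis
    by (auto simp: scaleC_one scaleC.zero_left split: if_splits)
qed

lemma fourier_coeff_trig_poly:
  assumes F: "finite F" "F \<subseteq> int_multi_indices" and P: "\<And>z. z \<in> torus \<Longrightarrow> P z = (\<Sum>\<alpha>\<in>F. monomial z \<alpha> *\<^sub>C c \<alpha>)"
    and \<alpha>: "\<alpha> \<in> int_multi_indices"
  shows "fourier_coeff P \<alpha> = (if \<alpha> \<in> F then c \<alpha> else 0)"
proof -
  have "has_bochner_int torus_measure (\<lambda>z. \<Sum>\<beta>\<in>F. monomial z (\<lambda>k. - \<alpha> k + \<beta> k) *\<^sub>C c \<beta>)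
      (\<Sum>\<beta>\<in>F. if (\<lambda>k. - \<alpha> k + \<beta> k) = (\<lambda>k. 0) then c \<beta> else 0)"
    using F(2) \<alpha> by (intro has_bochner_int_sum has_bochner_int_monomial int_multi_indices_add int_multi_indices_uminus) auto
  also have "(\<Sum>\<beta>\<in>F. if (\<lambda>k. - \<alpha> k + \<beta> k) = (\<lambda>k. 0) then c \<beta> else 0) = (\<Sum>\<beta>\<in>F. if \<beta> = \<alpha> then c \<beta> else 0)"
    by (intro sum.cong) (auto simp: fun_eq_iff)
  also have "\<dots> = (if \<alpha> \<in> F then c \<alpha> else 0)"
    using F(1) by simp
  finally have "has_bochner_int torus_measure (\<lambda>z. \<Sum>\<beta>\<in>F. monomial z (\<lambda>k. - \<alpha> k + \<beta> k) *\<^sub>C c \<beta>) (if \<alpha> \<in> F then c \<alpha> else 0)" .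
  moreover have "AE z in torus_measure. (\<Sum>\<beta>\<in>F. monomial z (\<lambda>k. - \<alpha> k + \<beta> k) *\<^sub>C c \<beta>) = monomial z (\<lambda>k. - \<alpha> k) *\<^sub>C P z"
  proof (rule AE_I2)
    fix z assume "z \<in> space torus_measure"
    then have z: "z \<in> torus" by (simp add: space_torus_measure)
    have "monomial z (\<lambda>k. - \<alpha> k + \<beta> k) = monomial z (\<lambda>k. - \<alpha> k) * monomial z \<beta>" if "\<beta> \<in> F" for \<beta>
      using that F(2) \<alpha> by (intro monomial_add z int_multi_indices_uminus) auto
    then show "(\<Sum>\<beta>\<in>F. monomial z (\<lambda>k. - \<alpha> k + \<beta> k) *\<^sub>C c \<beta>) = monomial z (\<lambda>k. - \<alpha> k) *\<^sub>C P z"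
      by (simp add: P[OF z] scaleC.sum_right scaleC_scaleC)
  qed
  ultimately show ?thesis
    unfolding fourier_coeff_def by (intro torus.bochner_int_eqI) (simp add: has_bochner_int_cong_AE)
qed

text \<open>Integrating \<open>h\<close> against the monomial with exponent \<open>\<alpha>\<close>
  gives its coefficient at \<open>-\<alpha>\<close>; as \<open>Q\<close> may contain any integer
  frequencies, the coefficients of \<open>h\<close> must vanish at all of them.\<close>

lemma has_bochner_int_trig_poly_mult:
  fixes h :: "(nat \<Rightarrow> complex) \<Rightarrow> 'a::complex_banach"
  assumes h: "bochner_integrable torus_measure h"
    and zero: "\<And>\<alpha>. \<alpha> \<in> int_multi_indices \<Longrightarrow> fourier_coeff h \<alpha> = 0"
    and Q: "trig_poly Q"
  shows "has_bochner_int torus_measure (\<lambda>z. Q z *\<^sub>C h z) 0"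
proof -
  obtain F c where F: "finite F" "F \<subseteq> int_multi_indices" "\<And>z. z \<in> torus \<Longrightarrow> Q z = (\<Sum>\<alpha>\<in>F. monomial z \<alpha> *\<^sub>C c \<alpha>)"
    using Q unfolding trig_poly_def by blast
  have "has_bochner_int torus_measure (\<lambda>z. c \<alpha> *\<^sub>C monomial z \<alpha> *\<^sub>C h z) 0" if "\<alpha> \<in> F" for \<alpha>
    using has_bochner_int_bounded_linear[OF scaleC.bounded_linear_right has_bochner_int_fourier_coeff[OF h, of "\<lambda>k. - \<alpha> k"], of "c \<alpha>"]
      zero[of "\<lambda>k. - \<alpha> k"] that F(2) int_multi_indices_uminus[of \<alpha>]
    by (auto simp: scaleC.zero_right)
  then have "has_bochner_int torus_measure (\<lambda>z. \<Sum>\<alpha>\<in>F. c \<alpha> *\<^sub>C monomial z \<alpha> *\<^sub>C h z) (\<Sum>\<alpha>\<in>F. 0)"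
    by (intro has_bochner_int_sum)
  moreover have "AE z in torus_measure. (\<Sum>\<alpha>\<in>F. c \<alpha> *\<^sub>C monomial z \<alpha> *\<^sub>C h z) = Q z *\<^sub>C h z"
    by (rule AE_I2) (simp add: space_torus_measure F(3) scaleC.sum_left scaleC_scaleC scaleC_complex_def mult.commute)
  ultimately show ?thesis
    using has_bochner_int_cong_AE by fastforce
qed

text \<open>Approximating the indicator by \<open>Q\<close> in L_1 is not enough, since
  \<open>h\<close> may be unbounded. Split \<open>h\<close> into \<open>h - s\<close> and a simple
  \<open>s\<close>: the first part is small in L_1 and meets the uniform bound 2, the second is
  bounded and meets the L_1 error of \<open>Q\<close>.\<close>

lemma bochner_int_indicator_eq_0:
  fixes h :: "(nat \<Rightarrow> complex) \<Rightarrow> 'a::complex_banach"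
  assumes h: "simple_limit torus_measure h" "bochner_integrable torus_measure h"
    and zero: "\<And>\<alpha>. \<alpha> \<in> int_multi_indices \<Longrightarrow> fourier_coeff h \<alpha> = 0"
    and A: "A \<in> sets torus_measure"
  shows "has_bochner_int torus_measure (\<lambda>z. indicator A z *\<^sub>C h z) 0"
proof -
  let ?x = "bochner_int torus_measure (\<lambda>z. indicator A z *\<^sub>C h z)"
  have x: "has_bochner_int torus_measure (\<lambda>z. indicator A z *\<^sub>C h z) ?x"
    using A by (intro torus.has_bochner_int_bochner_int bochner_integrable_scaleC_bounded[where B = 1] h)
      (auto simp: indicator_def)
  have "norm ?x \<le> e" if e: "e > 0" for e
  proof -
    obtain s where s: "simple_function torus_measure s" "(\<integral>\<^sup>+ z. ennreal (norm (h z - s z)) \<partial>torus_measure) < ennreal (e / 4)"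
      using bochner_integrable_simple_approx[OF h(2), of "e / 4"] e by auto
    \<comment> \<open>A bound for the finitely many values of \<open>s\<close>, made positive so
      that the tolerance for \<open>Q\<close> can be \<open>e / (2 * B)\<close>.\<close>
    define B where "B = 1 + (\<Sum>y\<in>s ` space torus_measure. norm y)"
    have B: "B > 0" unfolding B_def by (intro add_pos_nonneg sum_nonneg) auto
    have sB: "norm (s z) \<le> B" if "z \<in> space torus_measure" for z
    proof -
      have "norm (s z) \<le> (\<Sum>y\<in>s ` space torus_measure. norm y)"
        using s(1) that by (intro member_le_sum) (auto simp: simple_function_def)
      then show ?thesis by (simp add: B_def)
    qed
    obtain Q where Q: "trig_poly Q" "\<And>z. z \<in> torus \<Longrightarrow> cmod (indicator A z - Q z) \<le> 2"
      "(\<integral>\<^sup>+ z. ennreal (cmod (indicator A z - Q z)) \<partial>torus_measure) \<le> ennreal (e / (2 * B))"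
      using trig_poly_approx_indicator[OF A, of "e / (2 * B)"] e B by (metis divide_pos_pos mult_pos_pos zero_less_numeral)
    have [measurable]: "(\<lambda>z. norm (h z - s z)) \<in> borel_measurable torus_measure"
      by (intro borel_measurable_norm_simple_limit simple_limit_diff simple_limit_simple_function h s)
    have [measurable]: "(\<lambda>z. cmod (indicator A z - Q z)) \<in> borel_measurable torus_measure"
      using A borel_measurable_simple_limit[OF simple_limit_trig_poly[OF Q(1)]] by measurable
    have "ennreal (norm (?x - 0)) \<le> (\<integral>\<^sup>+ z. ennreal (norm (indicator A z *\<^sub>C h z - Q z *\<^sub>C h z)) \<partial>torus_measure)"
      by (intro torus.has_bochner_int_norm_diff_le x has_bochner_int_trig_poly_mult h zero Q)
    also have "\<dots> \<le> (\<integral>\<^sup>+ z. ennreal 2 * ennreal (norm (h z - s z)) + ennreal B * ennreal (cmod (indicator A z - Q z)) \<partial>torus_measure)"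
    proof (intro nn_integral_mono)
      fix z assume z: "z \<in> space torus_measure"
      have "norm (indicator A z *\<^sub>C h z - Q z *\<^sub>C h z) = cmod (indicator A z - Q z) * norm (h z)"
        by (simp add: norm_scaleC flip: scaleC.diff_left)
      also have "\<dots> \<le> cmod (indicator A z - Q z) * (norm (h z - s z) + norm (s z))"
        using norm_triangle_ineq[of "h z - s z" "s z"] by (intro mult_left_mono) auto
      also have "\<dots> \<le> 2 * norm (h z - s z) + B * cmod (indicator A z - Q z)"
        unfolding distrib_left
        using Q(2)[of z] z sB[OF z]
        by (intro add_mono mult_right_mono) (auto simp: space_torus_measure mult.commute[of B] intro: mult_left_mono)
      finally have "ennreal (norm (indicator A z *\<^sub>C h z - Q z *\<^sub>C h z))
          \<le> ennreal (2 * norm (h z - s z) + B * cmod (indicator A z - Q z))"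
        by (rule ennreal_leI)
      also have "\<dots> = ennreal 2 * ennreal (norm (h z - s z)) + ennreal B * ennreal (cmod (indicator A z - Q z))"
        using B by (simp add: ennreal_mult)
      finally show "ennreal (norm (indicator A z *\<^sub>C h z - Q z *\<^sub>C h z)) \<le> \<dots>" .
    qed
    also have "\<dots> = ennreal 2 * (\<integral>\<^sup>+ z. ennreal (norm (h z - s z)) \<partial>torus_measure)
        + ennreal B * (\<integral>\<^sup>+ z. ennreal (cmod (indicator A z - Q z)) \<partial>torus_measure)"
      by (simp add: nn_integral_add nn_integral_cmult)
    also have "\<dots> \<le> ennreal 2 * ennreal (e / 4) + ennreal B * ennreal (e / (2 * B))"
      using s(2) Q(3) by (intro add_mono mult_left_mono) auto
    also have "\<dots> = ennreal (2 * (e / 4)) + ennreal (B * (e / (2 * B)))"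
      using e B by (intro arg_cong2[where f = "(+)"] ennreal_mult[symmetric]) auto
    also have "\<dots> = ennreal (2 * (e / 4) + B * (e / (2 * B)))"
      using e B by (intro ennreal_plus[symmetric]) auto
    also have "\<dots> = ennreal e"
      using B by simp
    finally show ?thesis
      using e by (simp add: ennreal_le_iff)
  qed
  then have "?x = 0"
    using field_le_epsilon[of "norm ?x" 0] by simp
  then show ?thesis
    using x by simp
qed

text \<open>The integral of \<open>h\<close> over every measurable set is 0. On a level set A of a
  simple function s near \<open>h\<close>, with value x, this gives |x| mu(A) <= the integral of |h
  - s| over A. Summing over the level sets bounds the L_1 norm of s by that of h - s, so the norm of
  \<open>h\<close> is at most twice the error. No separability of \<open>X\<close> enters.\<close>

theorem fourier_coeff_unique:
  fixes h :: "(nat \<Rightarrow> complex) \<Rightarrow> 'a::complex_banach"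
  assumes h: "bochner_integrable torus_measure h"
    and zero: "\<And>\<alpha>. \<alpha> \<in> int_multi_indices \<Longrightarrow> fourier_coeff h \<alpha> = 0"
  shows "AE z in torus_measure. h z = 0"
proof -
  obtain g where g: "simple_limit torus_measure g" "AE x in torus_measure. h x = g x" "(\<integral>\<^sup>+ x. ennreal (norm (g x)) \<partial>torus_measure) < \<infinity>"
    using h by (rule bochner_integrableE)
  have gi: "bochner_integrable torus_measure g"
    using h bochner_integrable_cong_AE[OF g(2)] by simp
  have g0: "fourier_coeff g \<alpha> = 0" if "\<alpha> \<in> int_multi_indices" for \<alpha>
    using zero[OF that] fourier_coeff_cong_AE[OF g(2)] by metis
  note [measurable] = borel_measurable_norm_simple_limit[OF g(1)]
  have "(\<integral>\<^sup>+ z. ennreal (norm (g z)) \<partial>torus_measure) \<le> 0 + ennreal e" if e: "e > 0" for e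
  proof -
    obtain s where s: "simple_function torus_measure s" "(\<integral>\<^sup>+ z. ennreal (norm (g z - s z)) \<partial>torus_measure) < ennreal (e / 2)"
      using bochner_integrable_simple_approx[OF gi, of "e / 2"] e by auto
    let ?Y = "s ` space torus_measure" and ?A = "\<lambda>x. s -` {x} \<inter> space torus_measure"
    have A[measurable]: "?A x \<in> sets torus_measure" for x
      using s(1) by (rule simple_functionD)
    have Y: "finite ?Y"
      using s(1) by (simp add: simple_function_def)
    have [measurable]: "(\<lambda>z. norm (g z - s z)) \<in> borel_measurable torus_measure" "(\<lambda>z. norm (s z)) \<in> borel_measurable torus_measure"
      by (intro borel_measurable_norm_simple_limit simple_limit_diff simple_limit_simple_function g s)+
    have part: "(\<Sum>x\<in>?Y. indicator (?A x) z) = (1 :: ennreal)" if "z \<in> space torus_measure" for z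
    proof -
      have "(\<Sum>x\<in>?Y. indicator (?A x) z) = (\<Sum>x\<in>?Y. if x = s z then 1 else (0 :: ennreal))"
        using that by (intro sum.cong) (auto simp: indicator_def)
      also have "\<dots> = 1"
        using Y that by simp
      finally show ?thesis .
    qed
    have x: "ennreal (norm x) * emeasure torus_measure (?A x)
        \<le> (\<integral>\<^sup>+ z. indicator (?A x) z * ennreal (norm (g z - s z)) \<partial>torus_measure)" for x
    proof -
      have "has_bochner_integral torus_measure (\<lambda>z. indicator (?A x) z *\<^sub>R (1::complex)) (measure torus_measure (?A x) *\<^sub>R 1)"
        using A[of x] by (intro has_bochner_integral_indicator) (auto simp: torus.emeasure_eq_measure)
      from has_bochner_int_bounded_linear[OF scaleC.bounded_linear_left has_bochner_int_has_bochner_integral[OF this], of x]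
      have "has_bochner_int torus_measure (\<lambda>z. indicator (?A x) z *\<^sub>C x) (complex_of_real (measure torus_measure (?A x)) *\<^sub>C x)"
        by (simp add: scaleR_conv_of_real of_real_indicator)
      \<comment> \<open>The subtracted 0 is the integral of \<open>g\<close> over
        \<open>?A x\<close>, from \<open>bochner_int_indicator_eq_0\<close>.\<close>
      then have "ennreal (norm (complex_of_real (measure torus_measure (?A x)) *\<^sub>C x - 0))
          \<le> (\<integral>\<^sup>+ z. ennreal (norm (indicator (?A x) z *\<^sub>C x - indicator (?A x) z *\<^sub>C g z)) \<partial>torus_measure)"
        by (intro torus.has_bochner_int_norm_diff_le bochner_int_indicator_eq_0 g gi g0 A)
      also have "\<dots> = (\<integral>\<^sup>+ z. indicator (?A x) z * ennreal (norm (g z - s z)) \<partial>torus_measure)"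
        by (intro nn_integral_cong) (auto simp: indicator_def scaleC_one scaleC.zero_left norm_minus_commute)
      also have "ennreal (norm (complex_of_real (measure torus_measure (?A x)) *\<^sub>C x - 0)) = ennreal (norm x) * emeasure torus_measure (?A x)"
        by (simp add: norm_scaleC torus.emeasure_eq_measure mult.commute flip: ennreal_mult)
      finally show ?thesis .
    qed
    have "(\<integral>\<^sup>+ z. ennreal (norm (s z)) \<partial>torus_measure) = (\<integral>\<^sup>+ z. (\<Sum>x\<in>?Y. ennreal (norm x) * indicator (?A x) z) \<partial>torus_measure)"
    proof (intro nn_integral_cong)
      fix z assume z: "z \<in> space torus_measure"
      have "(\<Sum>x\<in>?Y. ennreal (norm x) * indicator (?A x) z) = (\<Sum>x\<in>?Y. ennreal (norm (s z)) * indicator (?A x) z)"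
        by (intro sum.cong) (auto simp: indicator_def)
      then show "ennreal (norm (s z)) = (\<Sum>x\<in>?Y. ennreal (norm x) * indicator (?A x) z)"
        using part[OF z] by (simp flip: sum_distrib_left)
    qed
    also have "\<dots> = (\<Sum>x\<in>?Y. ennreal (norm x) * emeasure torus_measure (?A x))"
      by (simp add: nn_integral_sum nn_integral_cmult_indicator)
    also have "\<dots> \<le> (\<Sum>x\<in>?Y. \<integral>\<^sup>+ z. indicator (?A x) z * ennreal (norm (g z - s z)) \<partial>torus_measure)"
      by (intro sum_mono x)
    also have "\<dots> = (\<integral>\<^sup>+ z. (\<Sum>x\<in>?Y. indicator (?A x) z * ennreal (norm (g z - s z))) \<partial>torus_measure)"
      by (simp add: nn_integral_sum)
    also have "\<dots> = (\<integral>\<^sup>+ z. ennreal (norm (g z - s z)) \<partial>torus_measure)"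
      by (intro nn_integral_cong) (simp add: part flip: sum_distrib_right)
    finally have s_le: "(\<integral>\<^sup>+ z. ennreal (norm (s z)) \<partial>torus_measure) \<le> (\<integral>\<^sup>+ z. ennreal (norm (g z - s z)) \<partial>torus_measure)" .
    have "(\<integral>\<^sup>+ z. ennreal (norm (g z)) \<partial>torus_measure) \<le> (\<integral>\<^sup>+ z. ennreal (norm (g z - s z)) + ennreal (norm (s z)) \<partial>torus_measure)"
    proof (intro nn_integral_mono)
      show "ennreal (norm (g z)) \<le> ennreal (norm (g z - s z)) + ennreal (norm (s z))" for z
        using norm_triangle_ineq[of "g z - s z" "s z"] by (simp add: ennreal_leI flip: ennreal_plus)
    qed
    also have "\<dots> = (\<integral>\<^sup>+ z. ennreal (norm (g z - s z)) \<partial>torus_measure) + (\<integral>\<^sup>+ z. ennreal (norm (s z)) \<partial>torus_measure)"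
      by (simp add: nn_integral_add)
    also have "\<dots> \<le> ennreal (e / 2) + ennreal (e / 2)"
      using s(2) s_le by (intro add_mono) auto
    also have "\<dots> = 0 + ennreal e"
      using e by (simp flip: ennreal_plus)
    finally show ?thesis .
  qed
  then have "(\<integral>\<^sup>+ z. ennreal (norm (g z)) \<partial>torus_measure) = 0"
    using ennreal_le_epsilon[of 0 "\<integral>\<^sup>+ z. ennreal (norm (g z)) \<partial>torus_measure"] by auto
  then have "AE z in torus_measure. ennreal (norm (g z)) = 0"
    by (subst (asm) nn_integral_0_iff_AE) auto
  then show ?thesis
    using g(2) by eventually_elim simp
qed

section \<open>Trigonometric polynomials and the circle\<close>

text \<open>The exponent that the monomial of \<open>\<alpha>\<close> acquires on
  \<open>curve m\<close>: the polynomial with coefficients \<open>\<alpha> k\<close>, evaluated at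
  \<open>m\<close>.\<close>

definition weight :: "nat \<Rightarrow> (nat \<Rightarrow> int) \<Rightarrow> int" where
  "weight m \<alpha> = (\<Sum>k | \<alpha> k \<noteq> 0. \<alpha> k * int m ^ k)"

lemma weight_superset: "finite K \<Longrightarrow> {k. \<alpha> k \<noteq> 0} \<subseteq> K \<Longrightarrow> weight m \<alpha> = (\<Sum>k\<in>K. \<alpha> k * int m ^ k)"
  unfolding weight_def by (intro sum.mono_neutral_left) auto

text \<open>Reduces injectivity of the weight on a finite set of exponents to its not vanishing on
  their nonzero differences.\<close>

lemma weight_diff:
  assumes "\<alpha> \<in> int_multi_indices" "\<beta> \<in> int_multi_indices"
  shows "weight m (\<lambda>k. \<alpha> k - \<beta> k) = weight m \<alpha> - weight m \<beta>"
proof -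
  let ?K = "{k. \<alpha> k \<noteq> 0} \<union> {k. \<beta> k \<noteq> 0}"
  have K: "finite ?K"
    using assms by (auto simp: int_multi_indices_def)
  have "weight m \<alpha> = (\<Sum>k\<in>?K. \<alpha> k * int m ^ k)" "weight m \<beta> = (\<Sum>k\<in>?K. \<beta> k * int m ^ k)"
    "weight m (\<lambda>k. \<alpha> k - \<beta> k) = (\<Sum>k\<in>?K. (\<alpha> k - \<beta> k) * int m ^ k)"
    by (rule weight_superset[OF K]; force)+
  then show ?thesis
    by (simp add: sum_subtractf left_diff_distrib)
qed

text \<open>For fixed nonzero \<open>\<alpha>\<close>, the weight is a nonzero polynomial in \<open>m\<close>.\<close>

lemma exists_weight_nonzero:
  assumes "finite G" "G \<subseteq> int_multi_indices"
  obtains m where "\<And>\<alpha>. \<alpha> \<in> G \<Longrightarrow> weight m \<alpha> = 0 \<longleftrightarrow> \<alpha> = (\<lambda>k. 0)"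
proof -
  define p where "p \<alpha> = (\<Sum>k | \<alpha> k \<noteq> 0. monom (\<alpha> k) k)" for \<alpha> :: "nat \<Rightarrow> int"
  have poly: "poly (p \<alpha>) (int m) = weight m \<alpha>" for \<alpha> m
    by (simp add: p_def weight_def poly_sum poly_monom)
  have "p \<alpha> \<noteq> 0" if \<alpha>: "\<alpha> \<in> G - {\<lambda>k. 0}" for \<alpha>
  proof -
    obtain j where j: "\<alpha> j \<noteq> 0" using \<alpha> by auto
    have "finite {k. \<alpha> k \<noteq> 0}"
      using \<alpha> assms(2) by (auto simp: int_multi_indices_def)
    then have "coeff (p \<alpha>) j = \<alpha> j"
      using j by (simp add: p_def coeff_sum)
    then show ?thesis using j by auto
  qed
  then have "finite (\<Union>\<alpha>\<in>G - {\<lambda>k. 0}. int -` {x. poly (p \<alpha>) x = 0})"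
    using assms(1) by (intro finite_UN_I finite_vimageI poly_roots_finite) auto
  then obtain m where "m \<notin> (\<Union>\<alpha>\<in>G - {\<lambda>k. 0}. int -` {x. poly (p \<alpha>) x = 0})"
    using ex_new_if_finite infinite_UNIV_nat by blast
  then have "weight m \<alpha> = 0 \<longleftrightarrow> \<alpha> = (\<lambda>k. 0)" if "\<alpha> \<in> G" for \<alpha>
    using that poly[of \<alpha> m] by (auto simp: weight_def)
  then show thesis by (rule that)
qed

definition curve :: "nat \<Rightarrow> complex \<Rightarrow> nat \<Rightarrow> complex" where
  "curve m \<zeta> = (\<lambda>k. \<zeta> powi (int m ^ k))"

lemma curve_in_torus: "cmod \<zeta> = 1 \<Longrightarrow> curve m \<zeta> \<in> torus"
  by (simp add: curve_def torus_def norm_power_int)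

lemma continuous_on_curve: "continuous_on (sphere 0 1) (curve m)"
  unfolding curve_def
  by (intro continuous_on_coordinatewise_then_product continuous_on_power_int continuous_on_id) auto

lemma monomial_curve:
  assumes "cmod \<zeta> = 1"
  shows "monomial (curve m \<zeta>) \<alpha> = \<zeta> powi weight m \<alpha>"
proof -
  have "\<zeta> \<noteq> 0" using assms by auto
  have "(\<Prod>k\<in>K. \<zeta> powi (\<alpha> k * int m ^ k)) = \<zeta> powi (\<Sum>k\<in>K. \<alpha> k * int m ^ k)" for K
    by (induction K rule: infinite_finite_induct) (auto simp: power_int_add \<open>\<zeta> \<noteq> 0\<close>)
  then show ?thesis
    by (simp add: monomial_def weight_def curve_def mult.commute flip: power_int_mult)
qed

interpretation circle: prob_space circle_measure
  by (rule prob_space_circle_measure)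

lemma borel_measurable_continuous_on_circle:
  assumes "continuous_on (sphere 0 1) f"
  shows "f \<in> borel_measurable circle_measure"
proof -
  have "f \<in> borel_measurable (restrict_space borel (sphere 0 1))"
    by (intro borel_measurable_continuous_on_restrict assms)
  moreover have "sets circle_measure = sets (restrict_space borel (sphere 0 1))"
    by (simp add: circle_measure_def)
  ultimately show ?thesis
    using measurable_cong_sets by blast
qed

lemma integrable_continuous_on_torus:
  fixes f :: "(nat \<Rightarrow> complex) \<Rightarrow> 'b::{banach, second_countable_topology}"
  assumes "continuous_on torus f"
  shows "integrable torus_measure f"
proof -
  have "compact (f ` torus)"
    by (intro compact_continuous_image assms compact_torus)
  then obtain B where B: "\<And>z. z \<in> torus \<Longrightarrow> norm (f z) \<le> B"
    using compact_imp_bounded bounded_iff by (metis image_eqI)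
  show ?thesis
    by (rule torus.integrable_const_bound[of _ B])
       (auto simp: borel_measurable_continuous_on_torus assms space_torus_measure B intro!: AE_I2)
qed

lemma integrable_continuous_on_circle:
  fixes f :: "complex \<Rightarrow> 'b::{banach, second_countable_topology}"
  assumes "continuous_on (sphere 0 1) f"
  shows "integrable circle_measure f"
proof -
  have "compact (f ` sphere 0 1)"
    by (intro compact_continuous_image assms compact_sphere)
  then obtain B where B: "\<And>z. z \<in> sphere 0 1 \<Longrightarrow> norm (f z) \<le> B"
    using compact_imp_bounded bounded_iff by (metis image_eqI)
  show ?thesis
    by (rule circle.integrable_const_bound[of _ B])
       (use B in \<open>auto simp: borel_measurable_continuous_on_circle assms space_circle_measure intro!: AE_I2\<close>)
qed

text \<open>The curves \<open>\<zeta> \<mapsto> (\<zeta>, \<zeta>^m, \<zeta>^(m^2), \<dots>)\<close> equidistribute on the torus.\<close>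

lemma integral_curve_approx:
  fixes g :: "(nat \<Rightarrow> complex) \<Rightarrow> real" and e :: real
  assumes g: "continuous_on torus g" and e: "e > 0" and G: "finite G" "G \<subseteq> int_multi_indices"
  obtains m where "\<And>\<alpha>. \<alpha> \<in> G \<Longrightarrow> weight m \<alpha> = 0 \<longleftrightarrow> \<alpha> = (\<lambda>k. 0)"
    "\<bar>(\<integral>\<zeta>. g (curve m \<zeta>) \<partial>circle_measure) - (\<integral>z. g z \<partial>torus_measure)\<bar> \<le> e"
proof -
  obtain Q where Q: "trig_poly Q" "\<And>z. z \<in> torus \<Longrightarrow> cmod (of_real (g z) - Q z) < e / 2"
    using trig_poly_approx_continuous[OF g, of "e / 2"] e by auto
  obtain H d where H: "finite H" "H \<subseteq> int_multi_indices" "\<And>z. z \<in> torus \<Longrightarrow> Q z = (\<Sum>\<alpha>\<in>H. monomial z \<alpha> *\<^sub>C d \<alpha>)"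
    using Q(1) unfolding trig_poly_def by blast
  \<comment> \<open>One \<open>m\<close> serves both the set \<open>G\<close> of the caller and the
    frequencies of the approximating polynomial \<open>Q\<close>.\<close>
  obtain m where m: "\<And>\<alpha>. \<alpha> \<in> G \<union> H \<Longrightarrow> weight m \<alpha> = 0 \<longleftrightarrow> \<alpha> = (\<lambda>k. 0)"
    using exists_weight_nonzero[of "G \<union> H"] G H by auto
  have cont: "continuous_on (sphere 0 1) (\<lambda>\<zeta>. f (curve m \<zeta>))" if "continuous_on torus f"
    for f :: "(nat \<Rightarrow> complex) \<Rightarrow> 'c::topological_space"
    by (rule continuous_on_compose2[OF that continuous_on_curve]) (auto simp: curve_in_torus)
  have Qc: "continuous_on torus Q"
    by (rule continuous_on_trig_poly[OF Q(1)])
  have gc: "continuous_on torus (\<lambda>z. complex_of_real (g z))"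
    by (intro continuous_intros g)
  have "(\<integral>\<zeta>. Q (curve m \<zeta>) \<partial>circle_measure) = (\<integral>\<zeta>. (\<Sum>\<alpha>\<in>H. \<zeta> powi weight m \<alpha> * d \<alpha>) \<partial>circle_measure)"
    by (intro Bochner_Integration.integral_cong)
       (auto simp: space_circle_measure H(3) curve_in_torus monomial_curve scaleC_complex_def)
  also have "\<dots> = (\<Sum>\<alpha>\<in>H. (\<integral>\<zeta>. \<zeta> powi weight m \<alpha> * d \<alpha> \<partial>circle_measure))"
    by (intro Bochner_Integration.integral_sum integrable_continuous_on_circle)
       (auto intro!: continuous_intros)
  \<comment> \<open>On the circle and on the torus alike the mean picks out the constant term,
    because the weight vanishes on \<open>H\<close> only for the zero exponent. So \<open>Q\<close>
    has exactly the same mean along the curve.\<close>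
  also have "\<dots> = (\<Sum>\<alpha>\<in>H. (\<integral>z. monomial z \<alpha> * d \<alpha> \<partial>torus_measure))"
    using H(2) m by (intro sum.cong refl) (auto simp: integral_powi_circle integral_monomial)
  also have "\<dots> = (\<integral>z. (\<Sum>\<alpha>\<in>H. monomial z \<alpha> * d \<alpha>) \<partial>torus_measure)"
    by (intro Bochner_Integration.integral_sum[symmetric] integrable_continuous_on_torus
        continuous_on_mult continuous_on_monomial continuous_on_const)
  also have "\<dots> = (\<integral>z. Q z \<partial>torus_measure)"
    by (intro Bochner_Integration.integral_cong) (auto simp: space_torus_measure H(3) scaleC_complex_def)
  finally have Qeq: "(\<integral>\<zeta>. Q (curve m \<zeta>) \<partial>circle_measure) = (\<integral>z. Q z \<partial>torus_measure)" .
  have 1: "cmod ((\<integral>\<zeta>. complex_of_real (g (curve m \<zeta>)) \<partial>circle_measure) - (\<integral>\<zeta>. Q (curve m \<zeta>) \<partial>circle_measure)) \<le> e / 2"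
  proof -
    have "cmod ((\<integral>\<zeta>. complex_of_real (g (curve m \<zeta>)) \<partial>circle_measure) - (\<integral>\<zeta>. Q (curve m \<zeta>) \<partial>circle_measure))
        = cmod (\<integral>\<zeta>. complex_of_real (g (curve m \<zeta>)) - Q (curve m \<zeta>) \<partial>circle_measure)"
      by (subst Bochner_Integration.integral_diff)
         (auto intro: integrable_continuous_on_circle cont[OF gc] cont[OF Qc])
    also have "\<dots> \<le> (\<integral>\<zeta>. cmod (complex_of_real (g (curve m \<zeta>)) - Q (curve m \<zeta>)) \<partial>circle_measure)"
      by (rule integral_norm_bound)
    also have "\<dots> \<le> e / 2"
      using Q(2) by (intro circle.integral_le_const integrable_continuous_on_circle continuous_on_norm
          continuous_on_diff cont[OF gc] cont[OF Qc] AE_I2)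
        (auto simp: space_circle_measure curve_in_torus less_imp_le)
    finally show ?thesis .
  qed
  have 2: "cmod ((\<integral>z. complex_of_real (g z) \<partial>torus_measure) - (\<integral>z. Q z \<partial>torus_measure)) \<le> e / 2"
  proof -
    have "cmod ((\<integral>z. complex_of_real (g z) \<partial>torus_measure) - (\<integral>z. Q z \<partial>torus_measure))
        = cmod (\<integral>z. complex_of_real (g z) - Q z \<partial>torus_measure)"
      by (subst Bochner_Integration.integral_diff) (auto intro: integrable_continuous_on_torus gc Qc)
    also have "\<dots> \<le> (\<integral>z. cmod (complex_of_real (g z) - Q z) \<partial>torus_measure)"
      by (rule integral_norm_bound)
    also have "\<dots> \<le> e / 2"
      using Q(2) by (intro torus.integral_le_const integrable_continuous_on_torus continuous_on_norm
          continuous_on_diff gc Qc AE_I2)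
        (auto simp: space_torus_measure less_imp_le)
    finally show ?thesis .
  qed
  have "cmod (complex_of_real (\<integral>\<zeta>. g (curve m \<zeta>) \<partial>circle_measure) - complex_of_real (\<integral>z. g z \<partial>torus_measure)) \<le> e / 2 + e / 2"
    using norm_triangle_mono[OF 1 2[unfolded norm_minus_commute[of "\<integral>z. complex_of_real (g z) \<partial>torus_measure"]]]
    by (simp add: Qeq)
  then have "\<bar>(\<integral>\<zeta>. g (curve m \<zeta>) \<partial>circle_measure) - (\<integral>z. g z \<partial>torus_measure)\<bar> \<le> e"
    by (simp flip: of_real_diff)
  then show thesis
    using m by (intro that[of m]) auto
qed

section \<open>The Hausdorff--Young inequality\<close>

text \<open>The cotype inequality speaks of the exponents 1 to N; arbitrary distinct integer
  frequencies are shifted into that range. Injectivity of \<open>w\<close> keeps the coefficients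
  apart, and the common factor has modulus 1.\<close>

lemma fourier_cotype_sum_circle:
  fixes c :: "'i \<Rightarrow> 'a::complex_banach" and w :: "'i \<Rightarrow> int"
  assumes cot: "fourier_cotype TYPE('a) q C" and F: "finite F" and inj: "inj_on w F"
  shows "(\<Sum>\<alpha>\<in>F. norm (c \<alpha>) powr q) powr (1 / q)
    \<le> C * (\<integral>z. norm (\<Sum>\<alpha>\<in>F. z powi w \<alpha> *\<^sub>C c \<alpha>) powr conj_exponent q \<partial>circle_measure)
          powr (1 / conj_exponent q)"
proof -
  \<comment> \<open>Dominates every frequency in absolute value; the summand 1 is there because the
    cotype sum starts at exponent 1.\<close>
  define L where "L = 1 + (\<Sum>\<alpha>\<in>F. \<bar>w \<alpha>\<bar>)"
  define \<phi> where "\<phi> \<alpha> = nat (L + w \<alpha>)" for \<alpha>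
  have pos: "L + w \<alpha> \<ge> 1" if "\<alpha> \<in> F" for \<alpha>
    using member_le_sum[of \<alpha> F "\<lambda>\<alpha>. \<bar>w \<alpha>\<bar>"] that F by (simp add: L_def)
  have inj\<phi>: "inj_on \<phi> F"
  proof (rule inj_onI)
    fix \<alpha> \<beta> assume *: "\<alpha> \<in> F" "\<beta> \<in> F" "\<phi> \<alpha> = \<phi> \<beta>"
    then have "w \<alpha> = w \<beta>"
      using pos[of \<alpha>] pos[of \<beta>] by (simp add: \<phi>_def)
    then show "\<alpha> = \<beta>" using inj * by (auto dest: inj_onD)
  qed
  \<comment> \<open>A convenient upper bound for all shifted frequencies, since each is a
    summand.\<close>
  define N where "N = (\<Sum>\<alpha>\<in>F. \<phi> \<alpha>)"
  have sub: "\<phi> ` F \<subseteq> {1..N}"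
    using pos member_le_sum[of _ F \<phi>] F by (force simp: \<phi>_def N_def)
  \<comment> \<open>Exponents in the range that are no shifted frequency receive the zero vector and
    contribute to neither side.\<close>
  define x where "x k = (if k \<in> \<phi> ` F then c (the_inv_into F \<phi> k) else 0)" for k
  have x: "x (\<phi> \<alpha>) = c \<alpha>" if "\<alpha> \<in> F" for \<alpha>
    using that inj\<phi> by (simp add: x_def the_inv_into_f_f)
  have x0: "x k = 0" if "k \<notin> \<phi> ` F" for k
    using that by (simp add: x_def)
  have "(\<Sum>k=1..N. norm (x k) powr q) = (\<Sum>k\<in>\<phi> ` F. norm (x k) powr q)"
    using sub x0 by (intro sum.mono_neutral_right) auto
  also have "\<dots> = (\<Sum>\<alpha>\<in>F. norm (c \<alpha>) powr q)"
    using inj\<phi> by (simp add: sum.reindex x)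
  finally have 1: "(\<Sum>k=1..N. norm (x k) powr q) = (\<Sum>\<alpha>\<in>F. norm (c \<alpha>) powr q)" .
  have 2: "norm (\<Sum>k=1..N. z ^ k *\<^sub>C x k) = norm (\<Sum>\<alpha>\<in>F. z powi w \<alpha> *\<^sub>C c \<alpha>)" if z: "cmod z = 1" for z
  proof -
    have z0: "z \<noteq> 0" using z by auto
    have "(\<Sum>k=1..N. z ^ k *\<^sub>C x k) = (\<Sum>k\<in>\<phi> ` F. z ^ k *\<^sub>C x k)"
      using sub x0 by (intro sum.mono_neutral_right) (auto simp: scaleC.zero_right)
    also have "\<dots> = (\<Sum>\<alpha>\<in>F. z ^ \<phi> \<alpha> *\<^sub>C c \<alpha>)"
      using inj\<phi> by (simp add: sum.reindex x)
    also have "\<dots> = (\<Sum>\<alpha>\<in>F. z powi L *\<^sub>C z powi w \<alpha> *\<^sub>C c \<alpha>)"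
    proof (intro sum.cong refl)
      fix \<alpha> assume "\<alpha> \<in> F"
      then have "z ^ \<phi> \<alpha> = z powi (L + w \<alpha>)"
        using pos[of \<alpha>] by (simp add: \<phi>_def power_int_def)
      then show "z ^ \<phi> \<alpha> *\<^sub>C c \<alpha> = z powi L *\<^sub>C z powi w \<alpha> *\<^sub>C c \<alpha>"
        using z0 by (simp add: power_int_add scaleC_scaleC)
    qed
    also have "\<dots> = z powi L *\<^sub>C (\<Sum>\<alpha>\<in>F. z powi w \<alpha> *\<^sub>C c \<alpha>)"
      by (simp add: scaleC.sum_right)
    finally show ?thesis
      by (simp add: norm_scaleC norm_power_int z)
  qed
  have "(\<integral>z. norm (\<Sum>k=1..N. z ^ k *\<^sub>C x k) powr conj_exponent q \<partial>circle_measure)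
      = (\<integral>z. norm (\<Sum>\<alpha>\<in>F. z powi w \<alpha> *\<^sub>C c \<alpha>) powr conj_exponent q \<partial>circle_measure)"
    by (intro Bochner_Integration.integral_cong) (auto simp: space_circle_measure 2 simp del: One_nat_def)
  then show ?thesis
    using cot[unfolded fourier_cotype_def, rule_format, where x = x and N = N] 1 by simp
qed

lemma Lp_norm_continuous_on_torus:
  assumes "continuous_on torus f" "p > 0"
  shows "Lp_norm p torus_measure f = (\<integral>z. norm (f z) powr p \<partial>torus_measure) powr (1 / p)"
proof -
  have "continuous_on torus (\<lambda>z. norm (f z) powr p)"
    using assms by (intro continuous_on_powr' continuous_on_norm continuous_on_const) auto
  then show ?thesis
    unfolding Lp_norm_def
    by (subst integral_eq_nn_integral) (auto intro: borel_measurable_continuous_on_torus)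
qed

lemma hausdorff_young_trig_poly:
  fixes P :: "(nat \<Rightarrow> complex) \<Rightarrow> 'a::complex_banach"
  assumes cot: "fourier_cotype TYPE('a) q C" and q: "q > 1" and C: "C \<ge> 0"
    and P: "trig_poly P" and S: "finite S" "S \<subseteq> int_multi_indices"
  shows "(\<Sum>\<alpha>\<in>S. norm (fourier_coeff P \<alpha>) powr q) powr (1 / q)
    \<le> C * Lp_norm (conj_exponent q) torus_measure P"
proof -
  let ?p = "conj_exponent q"
  have p: "?p > 0" using q by (simp add: conj_exponent_def)
  obtain F c where F: "finite F" "F \<subseteq> int_multi_indices" "\<And>z. z \<in> torus \<Longrightarrow> P z = (\<Sum>\<alpha>\<in>F. monomial z \<alpha> *\<^sub>C c \<alpha>)"
    using P unfolding trig_poly_def by blast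
  have "(\<Sum>\<alpha>\<in>S. norm (fourier_coeff P \<alpha>) powr q) = (\<Sum>\<alpha>\<in>S \<inter> F. norm (c \<alpha>) powr q)"
    using S by (intro sum.mono_neutral_cong_right) (auto simp: fourier_coeff_trig_poly[OF F] subset_iff)
  also have "\<dots> \<le> (\<Sum>\<alpha>\<in>F. norm (c \<alpha>) powr q)"
    using F(1) by (intro sum_mono2) auto
  finally have S_le: "(\<Sum>\<alpha>\<in>S. norm (fourier_coeff P \<alpha>) powr q) powr (1 / q) \<le> (\<Sum>\<alpha>\<in>F. norm (c \<alpha>) powr q) powr (1 / q)"
    using q by (intro powr_mono2 sum_nonneg) auto
  let ?g = "\<lambda>z. norm (P z) powr ?p" and ?I = "\<integral>z. norm (P z) powr ?p \<partial>torus_measure"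
  have g: "continuous_on torus ?g"
    using p by (intro continuous_on_powr' continuous_on_norm continuous_on_const continuous_on_trig_poly P) auto
  \<comment> \<open>All differences of frequencies of \<open>P\<close>: a weight without nontrivial
    zeros on \<open>?G\<close> is injective on \<open>F\<close>.\<close>
  let ?G = "(\<lambda>(\<alpha>, \<beta>). (\<lambda>k. \<alpha> k - \<beta> k)) ` (F \<times> F)"
  have G: "finite ?G" "?G \<subseteq> int_multi_indices"
    using F int_multi_indices_add[OF _ int_multi_indices_uminus] by force+
  have bd: "(\<Sum>\<alpha>\<in>F. norm (c \<alpha>) powr q) powr (1 / q) \<le> C * (?I + e) powr (1 / ?p)" if e: "e > 0" for e
  proof -
    obtain m where m: "\<And>\<alpha>. \<alpha> \<in> ?G \<Longrightarrow> weight m \<alpha> = 0 \<longleftrightarrow> \<alpha> = (\<lambda>k. 0)"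
      "\<bar>(\<integral>\<zeta>. ?g (curve m \<zeta>) \<partial>circle_measure) - ?I\<bar> \<le> e"
      using integral_curve_approx[OF g e G] by blast
    have inj: "inj_on (weight m) F"
    proof (rule inj_onI)
      fix \<alpha> \<beta> assume *: "\<alpha> \<in> F" "\<beta> \<in> F" "weight m \<alpha> = weight m \<beta>"
      then have "weight m (\<lambda>k. \<alpha> k - \<beta> k) = 0"
        using F(2) by (simp add: weight_diff subset_iff)
      then have "(\<lambda>k. \<alpha> k - \<beta> k) = (\<lambda>k. 0)"
        using m(1)[of "\<lambda>k. \<alpha> k - \<beta> k"] * by force
      then show "\<alpha> = \<beta>"
        by (simp add: fun_eq_iff)
    qed
    have "(\<integral>z. norm (\<Sum>\<alpha>\<in>F. z powi weight m \<alpha> *\<^sub>C c \<alpha>) powr ?p \<partial>circle_measure) = (\<integral>\<zeta>. ?g (curve m \<zeta>) \<partial>circle_measure)"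
      by (intro Bochner_Integration.integral_cong)
         (auto simp: space_circle_measure F(3) curve_in_torus monomial_curve)
    then have "(\<Sum>\<alpha>\<in>F. norm (c \<alpha>) powr q) powr (1 / q) \<le> C * (\<integral>\<zeta>. ?g (curve m \<zeta>) \<partial>circle_measure) powr (1 / ?p)"
      using fourier_cotype_sum_circle[OF cot F(1) inj, of c] by simp
    also have "\<dots> \<le> C * (?I + e) powr (1 / ?p)"
      using m(2) p C by (intro mult_left_mono powr_mono2 integral_nonneg_AE) auto
    finally show ?thesis .
  qed
  \<comment> \<open>The curve depends on \<open>e\<close>, but it no longer occurs in
    \<open>bd\<close>, so \<open>e\<close> may tend to 0 there.\<close>
  have "(\<lambda>n. C * (?I + inverse (real (Suc n))) powr (1 / ?p)) \<longlonglongrightarrow> C * (?I + 0) powr (1 / ?p)"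
    using p by (intro tendsto_intros tendsto_powr' LIMSEQ_inverse_real_of_nat) (auto intro!: always_eventually add_nonneg_nonneg integral_nonneg_AE)
  then have "(\<Sum>\<alpha>\<in>F. norm (c \<alpha>) powr q) powr (1 / q) \<le> C * (?I + 0) powr (1 / ?p)"
    by (rule LIMSEQ_le_const) (use bd in auto)
  then show ?thesis
    using S_le Lp_norm_continuous_on_torus[OF continuous_on_trig_poly[OF P] p] by simp
qed

text \<open>For x > t, the factor x^(1-p) in x = x^(1-p) x^p is at most t^(1-p). Integrated over a
  probability space it stands in for Hoelder's inequality: if the integral of |u|^p is at most t^p,
  that of |u| is at most 2t. The case t = 1 embeds L_p into L_1.\<close>

lemma le_add_powr:
  fixes x t p :: real
  assumes "x \<ge> 0" "t > 0" "p \<ge> 1"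
  shows "x \<le> t + t powr (1 - p) * x powr p"
proof (cases "x \<le> t")
  case True
  then show ?thesis using assms by (simp add: add_increasing2)
next
  case False
  then have "x = x powr (1 - p) * x powr p"
    using assms by (simp flip: powr_add)
  also have "\<dots> \<le> t powr (1 - p) * x powr p"
    using False assms by (intro mult_right_mono powr_mono2') auto
  finally show ?thesis using assms by simp
qed

text \<open>Convexity at a + b = (1-t) (a/(1-t)) + t (b/t). It stands in for Minkowski's inequality:
  the factor of a^p tends to 1 as t tends to 0, and a second term of size b^p <= t^p costs only
  t.\<close>

lemma powr_add_le_convex:
  fixes a b t p :: real
  assumes "a \<ge> 0" "b \<ge> 0" "0 < t" "t < 1" "p \<ge> 1"
  shows "(a + b) powr p \<le> (1 - t) powr (1 - p) * a powr p + t powr (1 - p) * b powr p"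
proof -
  have ge1: "1 \<le> u powr (1 - p)" if "0 < u" "u < 1" for u
    using that assms by (metis powr_one_eq_one powr_mono2' diff_le_0_iff_le less_imp_le)
  \<comment> \<open>Convexity is applied for positive arguments only; if one summand is 0,
    \<open>ge1\<close> settles the claim.\<close>
  consider "a = 0" | "b = 0" | "a > 0" "b > 0"
    using assms by linarith
  then show ?thesis
  proof cases
    case 1
    then show ?thesis
      using mult_right_mono[OF ge1[of t], of "b powr p"] assms by simp
  next
    case 2
    then show ?thesis
      using mult_right_mono[OF ge1[of "1 - t"], of "a powr p"] assms by simp
  next
    case 3
    have "((1 - t) *\<^sub>R (a / (1 - t)) + t *\<^sub>R (b / t)) powr p \<le> (1 - t) * (a / (1 - t)) powr p + t * (b / t) powr p"
      using assms 3 by (intro convex_onD[OF powr_convex]) auto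
    moreover have "u * (x / u) powr p = u powr (1 - p) * x powr p" if "u > 0" "x > 0" for u x
      using that by (simp add: powr_divide powr_diff)
    ultimately show ?thesis
      using assms 3 by simp
  qed
qed

section \<open>Hausdorff--Young from polynomials to all of L_q'\<close>

lemma (in finite_measure) bochner_integrable_Lp_space:
  assumes "f \<in> Lp_space p M" "p \<ge> 1"
  shows "bochner_integrable M f"
proof -
  have f: "strongly_measurable M f" "(\<integral>\<^sup>+ x. ennreal (norm (f x) powr p) \<partial>M) < \<infinity>"
    using assms(1) by (auto simp: Lp_space_def)
  obtain g where g: "simple_limit M g" "AE x in M. f x = g x"
    using f(1) by (rule strongly_measurableE)
  have "(\<integral>\<^sup>+ x. ennreal (norm (f x) powr p) \<partial>M) = (\<integral>\<^sup>+ x. ennreal (norm (g x) powr p) \<partial>M)"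
    using g(2) by (intro nn_integral_cong_AE) (auto elim: eventually_mono)
  then have fin: "(\<integral>\<^sup>+ x. ennreal (norm (g x) powr p) \<partial>M) < \<infinity>"
    using f(2) by simp
  note [measurable] = borel_measurable_norm_powr_simple_limit[OF g(1)]
  have "(\<integral>\<^sup>+ x. ennreal (norm (f x)) \<partial>M) \<le> (\<integral>\<^sup>+ x. 1 + ennreal (norm (g x) powr p) \<partial>M)"
  proof (intro nn_integral_mono_AE)
    show "AE x in M. ennreal (norm (f x)) \<le> 1 + ennreal (norm (g x) powr p)"
      using g(2)
    proof eventually_elim
      case (elim x)
      have "ennreal (norm (g x)) \<le> ennreal (1 + norm (g x) powr p)"
        using le_add_powr[of "norm (g x)" 1 p] assms(2) by (intro ennreal_leI) simp
      then show ?case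
        using elim by simp
    qed
  qed
  also have "\<dots> < \<infinity>"
    using fin by (simp add: nn_integral_add emeasure_eq_measure)
  finally show ?thesis
    using f(1) by (simp add: bochner_integrable_def)
qed

text \<open>Polynomial approximants converge coefficientwise, and their norms are asymptotically at
  most that of \<open>f\<close>. The index set \<open>S\<close> is finite so that the limit passes
  through the sum.\<close>

theorem hausdorff_young:
  fixes f :: "(nat \<Rightarrow> complex) \<Rightarrow> 'a::complex_banach"
  assumes cot: "fourier_cotype TYPE('a) q C" and q: "q > 1" and C: "C \<ge> 0"
    and f: "f \<in> Lp_space (conj_exponent q) torus_measure"
    and S: "finite S" "S \<subseteq> int_multi_indices"
  shows "(\<Sum>\<alpha>\<in>S. norm (fourier_coeff f \<alpha>) powr q) powr (1 / q)
    \<le> C * Lp_norm (conj_exponent q) torus_measure f"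
proof -
  define p where "p = conj_exponent q"
  have p: "p \<ge> 1" using q by (simp add: p_def conj_exponent_def field_simps)
  have f': "strongly_measurable torus_measure f" "(\<integral>\<^sup>+ x. ennreal (norm (f x) powr p) \<partial>torus_measure) < \<infinity>"
    using f by (auto simp: Lp_space_def p_def)
  obtain g where g: "simple_limit torus_measure g" "AE x in torus_measure. f x = g x"
    using f'(1) by (rule strongly_measurableE)
  have fg: "(\<integral>\<^sup>+ x. ennreal (norm (f x) powr p) \<partial>torus_measure) = (\<integral>\<^sup>+ x. ennreal (norm (g x) powr p) \<partial>torus_measure)"
    using g(2) by (intro nn_integral_cong_AE) (auto elim: eventually_mono)
  define I where "I = enn2real (\<integral>\<^sup>+ x. ennreal (norm (g x) powr p) \<partial>torus_measure)"
  have I: "(\<integral>\<^sup>+ x. ennreal (norm (g x) powr p) \<partial>torus_measure) = ennreal I" "I \<ge> 0"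
    using f'(2) fg by (auto simp: I_def)
  have fin: "(\<integral>\<^sup>+ x. ennreal (norm (g x) powr p) \<partial>torus_measure) < \<infinity>"
    by (simp add: I)
  have gi: "bochner_integrable torus_measure g"
    using torus.bochner_integrable_Lp_space[OF f] p bochner_integrable_cong_AE[OF g(2)] by (simp add: p_def)
  note [measurable] = borel_measurable_norm_powr_simple_limit[OF g(1)]
  \<comment> \<open>The single parameter \<open>t\<close> is both the L_p error of \<open>P\<close>
    and the weight in \<open>powr_add_le_convex\<close>; through \<open>le_add_powr\<close> it also
    bounds the coefficient errors by \<open>2 * t\<close>.\<close>
  have ex: "\<exists>P. trig_poly P \<and> (\<forall>\<alpha>. norm (fourier_coeff g \<alpha> - fourier_coeff P \<alpha>) \<le> 2 * t) \<and>
      Lp_norm p torus_measure P \<le> ((1 - t) powr (1 - p) * I + t) powr (1 / p)" if t: "0 < t" "t < 1" for t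
  proof -
    obtain P where P: "trig_poly P" "(\<integral>\<^sup>+ z. ennreal (norm (g z - P z) powr p) \<partial>torus_measure) \<le> ennreal (t powr p)"
      using trig_poly_dense[OF g(1) fin p, of "t powr p"] t by auto
    have tt: "t powr (1 - p) * t powr p = t"
      using t by (simp flip: powr_add)
    have [measurable]: "(\<lambda>z. norm (g z - P z) powr p) \<in> borel_measurable torus_measure"
      by (intro borel_measurable_norm_powr_simple_limit simple_limit_diff g simple_limit_trig_poly P)
    have "norm (fourier_coeff g \<alpha> - fourier_coeff P \<alpha>) \<le> 2 * t" for \<alpha>
    proof -
      have "ennreal (norm (fourier_coeff g \<alpha> - fourier_coeff P \<alpha>)) \<le> (\<integral>\<^sup>+ z. ennreal (norm (g z - P z)) \<partial>torus_measure)"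
        by (intro norm_fourier_coeff_diff_le gi bochner_integrable_trig_poly P)
      also have "\<dots> \<le> (\<integral>\<^sup>+ z. ennreal t + ennreal (t powr (1 - p)) * ennreal (norm (g z - P z) powr p) \<partial>torus_measure)"
        using le_add_powr[of "norm (g z - P z)" t p for z] t p
        by (intro nn_integral_mono) (simp add: ennreal_leI flip: ennreal_mult ennreal_plus)
      also have "\<dots> = ennreal t + ennreal (t powr (1 - p)) * (\<integral>\<^sup>+ z. ennreal (norm (g z - P z) powr p) \<partial>torus_measure)"
        by (simp add: nn_integral_add nn_integral_cmult torus.emeasure_space_1)
      also have "\<dots> \<le> ennreal t + ennreal (t powr (1 - p)) * ennreal (t powr p)"
        by (intro add_left_mono mult_left_mono P) auto
      also have "\<dots> = ennreal (2 * t)"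
        using t tt by (simp flip: ennreal_mult ennreal_plus)
      finally show ?thesis
        using t by (simp add: ennreal_le_iff)
    qed
    moreover have "Lp_norm p torus_measure P \<le> ((1 - t) powr (1 - p) * I + t) powr (1 / p)"
    proof -
      have "(\<integral>\<^sup>+ z. ennreal (norm (P z) powr p) \<partial>torus_measure)
          \<le> (\<integral>\<^sup>+ z. ennreal ((1 - t) powr (1 - p)) * ennreal (norm (g z) powr p)
              + ennreal (t powr (1 - p)) * ennreal (norm (g z - P z) powr p) \<partial>torus_measure)"
      proof (intro nn_integral_mono)
        fix z
        have "norm (P z) \<le> norm (g z) + norm (g z - P z)"
          using norm_triangle_sub[of "P z" "g z"] by (simp add: norm_minus_commute)
        then have "norm (P z) powr p \<le> (norm (g z) + norm (g z - P z)) powr p"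
          using p by (intro powr_mono2) auto
        also have "\<dots> \<le> (1 - t) powr (1 - p) * norm (g z) powr p + t powr (1 - p) * norm (g z - P z) powr p"
          using t p by (intro powr_add_le_convex) auto
        finally show "ennreal (norm (P z) powr p) \<le> ennreal ((1 - t) powr (1 - p)) * ennreal (norm (g z) powr p)
              + ennreal (t powr (1 - p)) * ennreal (norm (g z - P z) powr p)"
          by (simp add: ennreal_leI flip: ennreal_mult ennreal_plus)
      qed
      also have "\<dots> = ennreal ((1 - t) powr (1 - p)) * ennreal I
              + ennreal (t powr (1 - p)) * (\<integral>\<^sup>+ z. ennreal (norm (g z - P z) powr p) \<partial>torus_measure)"
        by (simp add: nn_integral_add nn_integral_cmult I)
      also have "\<dots> \<le> ennreal ((1 - t) powr (1 - p)) * ennreal I + ennreal (t powr (1 - p)) * ennreal (t powr p)"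
        by (intro add_left_mono mult_left_mono P) auto
      also have "\<dots> = ennreal ((1 - t) powr (1 - p) * I + t)"
        using t tt I(2) by (simp flip: ennreal_mult ennreal_plus)
      finally have "enn2real (\<integral>\<^sup>+ z. ennreal (norm (P z) powr p) \<partial>torus_measure) \<le> (1 - t) powr (1 - p) * I + t"
        using t I(2) by (intro enn2real_leI) auto
      then show ?thesis
        unfolding Lp_norm_def using p by (intro powr_mono2) auto
    qed
    ultimately show ?thesis using P(1) by blast
  qed
  \<comment> \<open>The double successor keeps \<open>t n\<close> strictly below 1 already at n = 0,
    as the weight requires.\<close>
  define t where "t n = inverse (real (Suc (Suc n)))" for n
  have t: "0 < t n" "t n < 1" for n
    by (auto simp: t_def inverse_less_1_iff)
  have t0: "t \<longlonglongrightarrow> 0"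
    unfolding t_def using LIMSEQ_Suc[OF LIMSEQ_inverse_real_of_nat] by simp
  have "\<forall>n. \<exists>P. trig_poly P \<and> (\<forall>\<alpha>. norm (fourier_coeff g \<alpha> - fourier_coeff P \<alpha>) \<le> 2 * t n) \<and>
      Lp_norm p torus_measure P \<le> ((1 - t n) powr (1 - p) * I + t n) powr (1 / p)"
    using ex t by simp
  from choice[OF this] obtain P where P: "\<And>n. trig_poly (P n)"
    "\<And>n \<alpha>. norm (fourier_coeff g \<alpha> - fourier_coeff (P n) \<alpha>) \<le> 2 * t n"
    "\<And>n. Lp_norm p torus_measure (P n) \<le> ((1 - t n) powr (1 - p) * I + t n) powr (1 / p)"
    by blast
  have lim: "(\<lambda>n. fourier_coeff (P n) \<alpha>) \<longlonglongrightarrow> fourier_coeff g \<alpha>" for \<alpha>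
  proof (rule LIM_zero_cancel, rule tendsto_norm_zero_cancel, rule tendsto_sandwich[OF _ _ tendsto_const])
    show "(\<lambda>n. 2 * t n) \<longlonglongrightarrow> 0"
      using tendsto_mult_right_zero[OF t0, of 2] .
  qed (use P(2) in \<open>auto simp: norm_minus_commute\<close>)
  have "(\<lambda>n. (\<Sum>\<alpha>\<in>S. norm (fourier_coeff (P n) \<alpha>) powr q) powr (1 / q))
      \<longlonglongrightarrow> (\<Sum>\<alpha>\<in>S. norm (fourier_coeff g \<alpha>) powr q) powr (1 / q)"
    using q by (intro tendsto_powr' tendsto_sum tendsto_norm lim tendsto_const)
      (auto intro!: always_eventually sum_nonneg)
  moreover have "(\<lambda>n. C * ((1 - t n) powr (1 - p) * I + t n) powr (1 / p))
      \<longlonglongrightarrow> C * ((1 - 0) powr (1 - p) * I + 0) powr (1 / p)"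
    using p t I(2) by (intro tendsto_intros tendsto_powr' t0)
      (auto intro!: always_eventually add_nonneg_nonneg mult_nonneg_nonneg simp: less_imp_le)
  moreover have "(\<Sum>\<alpha>\<in>S. norm (fourier_coeff (P n) \<alpha>) powr q) powr (1 / q)
      \<le> C * ((1 - t n) powr (1 - p) * I + t n) powr (1 / p)" for n
    using hausdorff_young_trig_poly[OF cot q C P(1) S] mult_left_mono[OF P(3)[of n] C]
    by (fastforce simp: p_def intro: order_trans)
  ultimately have "(\<Sum>\<alpha>\<in>S. norm (fourier_coeff g \<alpha>) powr q) powr (1 / q) \<le> C * I powr (1 / p)"
    using LIMSEQ_le[of _ _ _ "C * ((1 - 0) powr (1 - p) * I + 0) powr (1 / p)"] by fastforce
  moreover have "Lp_norm p torus_measure f = I powr (1 / p)"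
    by (simp add: Lp_norm_def fg I)
  ultimately show ?thesis
    using fourier_coeff_cong_AE[OF g(2)] I(2) by (simp add: p_def)
qed

section \<open>The Bohr correspondence\<close>

lemma infinite_primes_nat: "infinite {p::nat. prime p}"
  by (rule primes_infinite)

lemma prime_nth_prime: "prime (nth_prime k)"
  unfolding nth_prime_def using enumerate_in_set[OF infinite_primes_nat] by blast

lemma inj_nth_prime: "inj nth_prime"
  unfolding nth_prime_def by (rule inj_enumerate[OF infinite_primes_nat])

lemma nth_prime_surj:
  assumes "prime p"
  obtains k where "nth_prime k = p"
proof -
  have "p \<in> range (enumerate {p. prime p})"
    using assms range_enumerate[OF infinite_primes_nat] by simp
  then show thesis
    using that by (auto simp: nth_prime_def)
qed

lemma prime_exponents_prod:
  assumes "finite K"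
  shows "prime_exponents (\<Prod>k\<in>K. nth_prime k ^ e k) = (\<lambda>k. if k \<in> K then int (e k) else 0)"
proof
  fix k
  \<comment> \<open>The exponent as a function of the prime instead of its index, the form in which
    \<open>multiplicity_prod_prime_powers\<close> takes it.\<close>
  let ?f = "\<lambda>p. e (the_inv nth_prime p)"
  have "(\<Prod>k\<in>K. nth_prime k ^ e k) = (\<Prod>p\<in>nth_prime ` K. p ^ ?f p)"
    using inj_nth_prime
    by (subst prod.reindex) (auto intro: inj_on_subset simp: the_inv_f_f)
  moreover have "multiplicity (nth_prime k) (\<Prod>p\<in>nth_prime ` K. p ^ ?f p) = (if nth_prime k \<in> nth_prime ` K then ?f (nth_prime k) else 0)"
    using assms by (intro multiplicity_prod_prime_powers) (auto simp: prime_nth_prime)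
  ultimately show "prime_exponents (\<Prod>k\<in>K. nth_prime k ^ e k) k = (if k \<in> K then int (e k) else 0)"
    using inj_nth_prime by (simp add: prime_exponents_def the_inv_f_f inj_image_mem_iff)
qed

lemma prime_exponents_in: "n > 0 \<Longrightarrow> prime_exponents n \<in> nonneg_multi_indices"
proof -
  assume n: "n > 0"
  have "{k. prime_exponents n k \<noteq> 0} \<subseteq> nth_prime -` {p. p dvd n}"
    using not_dvd_imp_multiplicity_0 by (fastforce simp: prime_exponents_def)
  moreover have "finite (nth_prime -` {p. p dvd n})"
    using n by (intro finite_vimageI inj_nth_prime) auto
  ultimately have "finite {k. prime_exponents n k \<noteq> 0}"
    by (rule finite_subset)
  then show ?thesis
    by (auto simp: nonneg_multi_indices_def int_multi_indices_def prime_exponents_def)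
qed

text \<open>Unique factorisation: positive numbers with equal prime multiplicities agree, and a
  product of prime powers realises any finitely supported exponent. The range starts at 1 because
  \<open>multiplicity\<close> assigns to 0 the same exponents as to 1.\<close>

lemma bij_betw_prime_exponents: "bij_betw prime_exponents {1..} nonneg_multi_indices"
  unfolding bij_betw_def
proof
  show "inj_on prime_exponents {1..}"
  proof (rule inj_onI)
    fix m n :: nat assume mn: "m \<in> {1..}" "n \<in> {1..}" "prime_exponents m = prime_exponents n"
    have "multiplicity p m = multiplicity p n" if p: "prime p" for p
    proof -
      obtain k where "nth_prime k = p" using p by (rule nth_prime_surj)
      then show ?thesis
        using fun_cong[OF mn(3), of k] by (simp add: prime_exponents_def)
    qed
    then show "m = n"
      using mn by (metis atLeast_iff less_le_trans multiplicity_eq_nat zero_less_one)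
  qed
  show "prime_exponents ` {1..} = nonneg_multi_indices"
  proof
    show "prime_exponents ` {1..} \<subseteq> nonneg_multi_indices"
      using prime_exponents_in by auto
    show "nonneg_multi_indices \<subseteq> prime_exponents ` {1..}"
    proof
      fix \<alpha> assume \<alpha>: "\<alpha> \<in> nonneg_multi_indices"
      let ?K = "{k. \<alpha> k \<noteq> 0}"
      let ?n = "\<Prod>k\<in>?K. nth_prime k ^ nat (\<alpha> k)"
      have "prime_exponents ?n = (\<lambda>k. if k \<in> ?K then int (nat (\<alpha> k)) else 0)"
        using \<alpha> by (intro prime_exponents_prod) (auto simp: nonneg_multi_indices_def int_multi_indices_def)
      also have "\<dots> = \<alpha>"
        using \<alpha> by (auto simp: nonneg_multi_indices_def fun_eq_iff)
      finally have "\<alpha> = prime_exponents ?n" ..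
      moreover have "?n \<ge> 1"
        using prime_nth_prime by (simp add: prod_pos prime_gt_0_nat Suc_le_eq)
      ultimately show "\<alpha> \<in> prime_exponents ` {1..}" by auto
    qed
  qed
qed

lemma bohr_transform_summable_iff:
  "(\<lambda>n. norm (bohr_transform f n) powr q) summable_on {1..} \<longleftrightarrow>
   (\<lambda>\<alpha>. norm (fourier_coeff f \<alpha>) powr q) summable_on nonneg_multi_indices"
proof -
  have "(\<lambda>n. norm (bohr_transform f n) powr q) summable_on {1..} \<longleftrightarrow>
      (\<lambda>n. norm (fourier_coeff f (prime_exponents n)) powr q) summable_on {1..}"
    by (intro summable_on_cong) (auto simp: bohr_transform_def)
  also have "\<dots> \<longleftrightarrow> (\<lambda>\<alpha>. norm (fourier_coeff f \<alpha>) powr q) summable_on nonneg_multi_indices"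
    by (rule summable_on_reindex_bij_betw[OF bij_betw_prime_exponents])
  finally show ?thesis .
qed

lemma bohr_transform_infsum:
  "(\<Sum>\<^sub>\<infinity>n\<in>{1..}. norm (bohr_transform f n) powr q) =
   (\<Sum>\<^sub>\<infinity>\<alpha>\<in>nonneg_multi_indices. norm (fourier_coeff f \<alpha>) powr q)"
proof -
  have "(\<Sum>\<^sub>\<infinity>n\<in>{1..}. norm (bohr_transform f n) powr q) =
      (\<Sum>\<^sub>\<infinity>n\<in>{1..}. norm (fourier_coeff f (prime_exponents n)) powr q)"
    by (intro infsum_cong) (auto simp: bohr_transform_def)
  also have "\<dots> = (\<Sum>\<^sub>\<infinity>\<alpha>\<in>nonneg_multi_indices. norm (fourier_coeff f \<alpha>) powr q)"
    by (rule infsum_reindex_bij_betw[OF bij_betw_prime_exponents])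
  finally show ?thesis .
qed

text \<open>The Bohr transform records only the nonnegative frequencies; at the others both
  coefficients are 0 by membership in \<open>hardy_space\<close>. So all coefficients agree and the
  functions are a.e. equal.\<close>

lemma Lp_norm_eq_if_bohr_transform_eq:
  assumes f: "f \<in> hardy_space p" and g: "g \<in> hardy_space p" and p: "p \<ge> 1"
    and eq: "bohr_transform f = bohr_transform g"
  shows "Lp_norm p torus_measure f = Lp_norm p torus_measure g"
proof -
  have int: "bochner_integrable torus_measure f" "bochner_integrable torus_measure g"
    using f g p torus.bochner_integrable_Lp_space by (auto simp: hardy_space_def)
  have "fourier_coeff f \<alpha> = fourier_coeff g \<alpha>" if "\<alpha> \<in> int_multi_indices" for \<alpha>
  proof (cases "\<alpha> \<in> nonneg_multi_indices")
    case True
    then obtain n where "n \<ge> 1" "\<alpha> = prime_exponents n"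
      using bij_betw_imp_surj_on[OF bij_betw_prime_exponents] by auto
    then show ?thesis
      using fun_cong[OF eq, of n] by (simp add: bohr_transform_def)
  next
    case False
    then show ?thesis
      using f g that by (simp add: hardy_space_def)
  qed
  then have "AE z in torus_measure. f z - g z = 0"
    by (intro fourier_coeff_unique bochner_integrable_diff int) (simp add: fourier_coeff_diff int)
  then have "(\<integral>\<^sup>+ z. ennreal (norm (f z) powr p) \<partial>torus_measure) = (\<integral>\<^sup>+ z. ennreal (norm (g z) powr p) \<partial>torus_measure)"
    by (intro nn_integral_cong_AE) (auto elim: eventually_mono)
  then show ?thesis
    by (simp add: Lp_norm_def)
qed

lemma hardy_dirichlet_norm_bohr_transform:
  assumes "f \<in> hardy_space p" "p \<ge> 1"
  shows "hardy_dirichlet_norm p (bohr_transform f) = Lp_norm p torus_measure f"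
proof -
  let ?g = "inv_into (hardy_space p) bohr_transform (bohr_transform f)"
  have "bohr_transform f \<in> bohr_transform ` hardy_space p"
    using assms(1) by (rule imageI)
  then have "?g \<in> hardy_space p" "bohr_transform ?g = bohr_transform f"
    by (rule inv_into_into, rule f_inv_into_f)
  then show ?thesis
    unfolding hardy_dirichlet_norm_def using assms by (intro Lp_norm_eq_if_bohr_transform_eq)
qed

section \<open>Recovering the Fourier cotype\<close>

lemma Lp_space_trig_poly:
  assumes "trig_poly P" "p > 0"
  shows "P \<in> Lp_space p torus_measure"
proof -
  have "continuous_on torus (\<lambda>z. norm (P z) powr p)"
    using assms by (intro continuous_on_powr' continuous_on_norm continuous_on_const continuous_on_trig_poly) auto
  then have "integrable torus_measure (\<lambda>z. norm (P z) powr p)"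
    by (rule integrable_continuous_on_torus)
  then have "(\<integral>\<^sup>+ z. ennreal (norm (P z) powr p) \<partial>torus_measure) < \<infinity>"
    by (simp add: integrable_iff_bounded)
  then show ?thesis
    using strongly_measurable_simple_limit[OF simple_limit_trig_poly[OF assms(1)]]
    by (simp add: Lp_space_def)
qed

lemma integral_torus_coordinate:
  fixes g :: "complex \<Rightarrow> 'b::{banach, second_countable_topology}"
  assumes "continuous_on (sphere 0 1) g"
  shows "(\<integral>z. g (z k) \<partial>torus_measure) = (\<integral>\<zeta>. g \<zeta> \<partial>circle_measure)"
proof -
  have "distr torus_measure circle_measure (\<lambda>z. z k) = circle_measure"
    unfolding torus_measure_def by (intro distr_PiM_component prob_space_circle_measure) simp
  moreover have "(\<lambda>z. z k) \<in> torus_measure \<rightarrow>\<^sub>M circle_measure"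
    unfolding torus_measure_def by (rule measurable_component_singleton) simp
  ultimately show ?thesis
    using integral_distr[OF _ borel_measurable_continuous_on_circle[OF assms]] by metis
qed

lemma fourier_cotypeI:
  assumes q: "q > 1"
    and ineq: "\<And>f :: (nat \<Rightarrow> complex) \<Rightarrow> 'a::complex_banach. f \<in> hardy_space (conj_exponent q) \<Longrightarrow>
      (\<lambda>\<alpha>. norm (fourier_coeff f \<alpha>) powr q) summable_on nonneg_multi_indices \<and>
      (\<Sum>\<^sub>\<infinity>\<alpha>\<in>nonneg_multi_indices. norm (fourier_coeff f \<alpha>) powr q) powr (1 / q)
        \<le> C * Lp_norm (conj_exponent q) torus_measure f"
  shows "fourier_cotype TYPE('a) q C"
  unfolding fourier_cotype_def
proof (intro allI)
  fix N and x :: "nat \<Rightarrow> 'a"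
  let ?p = "conj_exponent q"
  have p: "?p > 0" using q by (simp add: conj_exponent_def)
  \<comment> \<open>\<open>e k\<close> is the exponent of the k-th power of coordinate 0, and
    \<open>c\<close> below reads k back from it, so that \<open>c (e k) = x k\<close>.\<close>
  define e where "e k = (\<lambda>j::nat. if j = 0 then int k else 0)" for k
  define c where "c \<alpha> = x (nat (\<alpha> 0))" for \<alpha> :: "nat \<Rightarrow> int"
  define F where "F = e ` {1..N}"
  define f where "f z = (\<Sum>\<alpha>\<in>F. monomial z \<alpha> *\<^sub>C c \<alpha>)" for z
  have inj: "inj_on e {1..N}"
    by (rule inj_onI) (auto simp: e_def dest: fun_cong[of _ _ 0])
  have e: "e k \<in> nonneg_multi_indices" for k
    using int_multi_indices_single[of 0 "int k"] by (auto simp: e_def nonneg_multi_indices_def)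
  have F: "finite F" "F \<subseteq> nonneg_multi_indices" "F \<subseteq> int_multi_indices"
    using e by (auto simp: F_def nonneg_multi_indices_def)
  have f: "trig_poly f"
    unfolding trig_poly_def f_def using F by blast
  have coeff: "fourier_coeff f \<alpha> = (if \<alpha> \<in> F then c \<alpha> else 0)" if "\<alpha> \<in> int_multi_indices" for \<alpha>
    using F that by (intro fourier_coeff_trig_poly) (auto simp: f_def)
  have "f \<in> hardy_space ?p"
    using Lp_space_trig_poly[OF f p] F by (auto simp: hardy_space_def coeff)
  note * = ineq[OF this]
  have "(\<Sum>k=1..N. norm (x k) powr q) = (\<Sum>\<alpha>\<in>F. norm (fourier_coeff f \<alpha>) powr q)"
  proof -
    have "fourier_coeff f (e k) = x k" if "k \<in> {1..N}" for k
    proof -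
      have "e k \<in> F" "e k \<in> int_multi_indices"
        using that F by (auto simp: F_def)
      then show ?thesis
        by (simp add: coeff c_def) (simp add: e_def)
    qed
    then show ?thesis
      unfolding F_def by (subst sum.reindex[OF inj]) simp
  qed
  \<comment> \<open>This uses the summability in \<open>ineq\<close>: for a non-summable family
    \<open>infsum\<close> is 0 and would not bound the finite sum.\<close>
  also have "\<dots> \<le> (\<Sum>\<^sub>\<infinity>\<alpha>\<in>nonneg_multi_indices. norm (fourier_coeff f \<alpha>) powr q)"
    using * F by (intro finite_sum_le_infsum) auto
  finally have "(\<Sum>k=1..N. norm (x k) powr q) powr (1 / q)
      \<le> (\<Sum>\<^sub>\<infinity>\<alpha>\<in>nonneg_multi_indices. norm (fourier_coeff f \<alpha>) powr q) powr (1 / q)"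
    using q by (intro powr_mono2 sum_nonneg) auto
  also have "\<dots> \<le> C * Lp_norm ?p torus_measure f"
    using * by simp
  also have "Lp_norm ?p torus_measure f = (\<integral>z. norm (f z) powr ?p \<partial>torus_measure) powr (1 / ?p)"
    by (rule Lp_norm_continuous_on_torus[OF continuous_on_trig_poly[OF f] p])
  also have "(\<integral>z. norm (f z) powr ?p \<partial>torus_measure) = (\<integral>z. norm (\<Sum>k=1..N. z 0 ^ k *\<^sub>C x k) powr ?p \<partial>torus_measure)"
    unfolding f_def F_def sum.reindex[OF inj] by (simp add: c_def) (simp add: e_def monomial_single)
  also have "\<dots> = (\<integral>\<zeta>. norm (\<Sum>k=1..N. \<zeta> ^ k *\<^sub>C x k) powr ?p \<partial>circle_measure)"
    using p by (intro integral_torus_coordinate continuous_on_powr' continuous_on_norm continuous_on_sum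
        scaleC.continuous_on continuous_on_power continuous_on_id continuous_on_const) auto
  finally show "(\<Sum>k=1..N. norm (x k) powr q) powr (1 / q)
      \<le> C * (\<integral>z. norm (\<Sum>k=1..N. z ^ k *\<^sub>C x k) powr ?p \<partial>circle_measure) powr (1 / ?p)" .
qed

text \<open>The finite inequality bounds all partial sums by \<open>R powr q\<close>, which gives
  summability and, after taking the supremum and the q-th root, the estimate itself.\<close>

lemma hausdorff_young_infsum:
  fixes f :: "(nat \<Rightarrow> complex) \<Rightarrow> 'a::complex_banach"
  assumes cot: "fourier_cotype TYPE('a) q C" and q: "q > 1" and C: "C \<ge> 0"
    and f: "f \<in> Lp_space (conj_exponent q) torus_measure"
  shows "(\<lambda>\<alpha>. norm (fourier_coeff f \<alpha>) powr q) summable_on nonneg_multi_indices"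
    and "(\<Sum>\<^sub>\<infinity>\<alpha>\<in>nonneg_multi_indices. norm (fourier_coeff f \<alpha>) powr q) powr (1 / q)
      \<le> C * Lp_norm (conj_exponent q) torus_measure f"
proof -
  define R where "R = C * Lp_norm (conj_exponent q) torus_measure f"
  have R: "R \<ge> 0"
    using C by (simp add: R_def Lp_norm_def)
  have le: "(\<Sum>\<alpha>\<in>S. norm (fourier_coeff f \<alpha>) powr q) \<le> R powr q"
    if S: "finite S" "S \<subseteq> nonneg_multi_indices" for S
  proof -
    have "(\<Sum>\<alpha>\<in>S. norm (fourier_coeff f \<alpha>) powr q) powr (1 / q) \<le> R"
      unfolding R_def using S by (intro hausdorff_young cot q C f) (auto simp: nonneg_multi_indices_def)
    then have "((\<Sum>\<alpha>\<in>S. norm (fourier_coeff f \<alpha>) powr q) powr (1 / q)) powr q \<le> R powr q"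
      using q by (intro powr_mono2) auto
    then show ?thesis
      using q by (simp add: powr_powr sum_nonneg)
  qed
  show *: "(\<lambda>\<alpha>. norm (fourier_coeff f \<alpha>) powr q) summable_on nonneg_multi_indices"
    by (rule nonneg_bdd_above_summable_on) (auto intro!: bdd_aboveI[of _ "R powr q"] le)
  have "(\<Sum>\<^sub>\<infinity>\<alpha>\<in>nonneg_multi_indices. norm (fourier_coeff f \<alpha>) powr q) \<le> R powr q"
    by (intro infsum_le_finite_sums * le)
  then have "(\<Sum>\<^sub>\<infinity>\<alpha>\<in>nonneg_multi_indices. norm (fourier_coeff f \<alpha>) powr q) powr (1 / q) \<le> (R powr q) powr (1 / q)"
    using q by (intro powr_mono2 infsum_nonneg) auto
  then show "(\<Sum>\<^sub>\<infinity>\<alpha>\<in>nonneg_multi_indices. norm (fourier_coeff f \<alpha>) powr q) powr (1 / q)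
      \<le> C * Lp_norm (conj_exponent q) torus_measure f"
    using q R by (simp add: powr_powr flip: R_def)
qed

text \<open>Finiteness of the series is spelled out as \<open>summable_on\<close>, since
  \<open>infsum\<close> returns 0 on a divergent series and the inequality alone would then say
  nothing.\<close>

theorem proposition2p1:
  fixes q C :: real
  assumes "2 \<le> q" and "1 \<le> C"
  shows "(fourier_cotype TYPE('a::complex_banach) q C \<longleftrightarrow>
           (\<forall>a :: nat \<Rightarrow> 'a. a \<in> hardy_dirichlet (conj_exponent q) \<longrightarrow>
              (\<lambda>n. norm (a n) powr q) summable_on {1..} \<and>
              (\<Sum>\<^sub>\<infinity>n\<in>{1..}. norm (a n) powr q) powr (1 / q)
                \<le> C * hardy_dirichlet_norm (conj_exponent q) a))
       \<and> (fourier_cotype TYPE('a) q C \<longleftrightarrow>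
           (\<forall>f :: (nat \<Rightarrow> complex) \<Rightarrow> 'a. f \<in> hardy_space (conj_exponent q) \<longrightarrow>
              (\<lambda>\<alpha>. norm (fourier_coeff f \<alpha>) powr q) summable_on nonneg_multi_indices \<and>
              (\<Sum>\<^sub>\<infinity>\<alpha>\<in>nonneg_multi_indices. norm (fourier_coeff f \<alpha>) powr q) powr (1 / q)
                \<le> C * Lp_norm (conj_exponent q) torus_measure f))"
    (is "(?A \<longleftrightarrow> ?B) \<and> (?A \<longleftrightarrow> ?C)")
proof -
  have q: "q > 1" and C: "C \<ge> 0" and p: "conj_exponent q \<ge> 1"
    using assms by (auto simp: conj_exponent_def)
  have "?A \<longleftrightarrow> ?C"
  proof
    assume ?A
    then show ?C
      using hausdorff_young_infsum[OF _ q C] by (auto simp: hardy_space_def)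
  next
    assume ?C
    then show ?A
      by (intro fourier_cotypeI q) blast
  qed
  moreover have "?B \<longleftrightarrow> ?C"
  proof -
    let ?P = "\<lambda>a :: nat \<Rightarrow> 'a. (\<lambda>n. norm (a n) powr q) summable_on {1..} \<and>
      (\<Sum>\<^sub>\<infinity>n\<in>{1..}. norm (a n) powr q) powr (1 / q) \<le> C * hardy_dirichlet_norm (conj_exponent q) a"
    \<comment> \<open>Dirichlet series in the space are exactly the images
      \<open>bohr_transform f\<close>, so the quantifier moves to \<open>f\<close>; summability, sum
      and norm are then translated one by one.\<close>
    have "?B \<longleftrightarrow> (\<forall>f\<in>hardy_space (conj_exponent q). ?P (bohr_transform f))"
      unfolding hardy_dirichlet_def by blast
    also have "\<dots> \<longleftrightarrow> ?C"
      unfolding bohr_transform_summable_iff bohr_transform_infsum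
      using hardy_dirichlet_norm_bohr_transform[OF _ p] by auto
    finally show ?thesis .
  qed
  ultimately show ?thesis by blast
qed

end
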